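(* Let $1<q<+\infty$. Let $L\colon[a,b]\times\mathbb{R}^{n}\times\mathbb{R}^n\to\mathbb{R}^d$, $(t,y,p)\mapsto L(t,y,p)$, be of class $C^1$ and suppose there are constants $K_1,K_2$ such that for every component $L_i$ and all $t\in[a,b]$, $y,p\in\mathbb{R}^n$, $$|L_i(t,y,p)|\le K_1(|y|^q+|p|^q+1),\quad |D_pL_i(t,y,p)|\le K_2(|y|^{q-1}+|p|^{q-1}+1),\quad |D_yL_i(t,y,p)|\le K_2(|y|^{q-1}+|p|^{q-1}+1).$$ Let $M\subset\mathcal{X}_1$ be an infimizer for $\overline J$. Given $\zeta\in C^+\setminus\{0\}$, suppose that there exists a $\zeta$-solution $y_\zeta\in M$. Then for any $v\in W_0^{1,q}([a,b];\mathbb{R}^n)$ $$\widehat J'_\zeta(0;M)(v)=S_{(\varphi'_{\zeta,M}(0),\zeta)}(v)=H^+(\zeta).$$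
   Context: Let $a<b$ be real, $n\ge 1$, $d>1$ integers, $A,B\in\mathbb{R}^n$, and let $\emptyset\neq C\subsetneq\mathbb{R}^d$ be a closed convex cone with dual $C^+=\{\zeta\in\mathbb{R}^d\mid \zeta\cdot z\ge 0\ \forall z\in C\}$. Let $\mathcal{G}(\mathbb{R}^d,C)=\{D\subseteq\mathbb{R}^d\mid D=\mathrm{cl\,co}(D+C)\}$, ordered by $\supseteq$; the infimum of a family is the closed convex hull of its union. Put $\mathcal{X}_1=\{y\in W^{1,q}([a,b];\mathbb{R}^n)\mid y(a)=A,\ y(b)=B\}$ (using continuous representatives), $J(y)=\int_a^bL(t,y(t),\dot y(t))\,dt\in\mathbb{R}^d$, $\overline J\colon\mathcal{X}_1\to\mathcal{G}(\mathbb{R}^d,C)$, $\overline J(y)=J(y)+C$, $J_\zeta(y)=\zeta\cdot J(y)$; $D_y,D_p$ denote gradients in $y$ and in $p$. A set $M\subseteq\mathcal{X}_1$ is an infimizer for $\overline J$ if $\mathrm{cl\,co}\bigcup_{y\in M}\overline J(y)=\mathrm{cl\,co}\bigcup_{y\in\mathcal{X}_1}\overline J(y)$. A $\zeta$-solution is an arc $y_\zeta\in\mathcal{X}_1$ with $J_\zeta(y_\zeta)=\inf_{y\in\mathcal{X}_1}J_\zeta(y)$. The inf-translation is $\widehat J(v;M)=\mathrm{cl\,co}\bigcup_{y\in M}\overline J(y+v)$ for $v\in W^{1,q}_0([a,b];\mathbb{R}^n)$, and $\varphi_{\zeta,M}(v)=\inf_{z\in\widehat J(v;M)}\zeta\cdot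 z=\inf_{y\in M}J_\zeta(y+v)$; $\varphi'_{\zeta,M}(0)$ is its Fréchet derivative at $0$ on $W_0^{1,q}([a,b];\mathbb{R}^n)$, which exists under the hypotheses of the claim. For $\zeta\in C^+\setminus\{0\}$: $H^+(\zeta)=\{z\in\mathbb{R}^d\mid\zeta\cdot z\ge0\}$; for a continuous linear functional $\xi$, $S_{(\xi,\zeta)}(v)=\{z\in\mathbb{R}^d\mid\zeta\cdot z\ge\xi(v)\}$; the $\zeta$-difference of two sets is $D-_\zeta E=\{z\in\mathbb{R}^d\mid z+E\subseteq\mathrm{cl}(D+H^+(\zeta))\}=\{z\mid\zeta\cdot z+\inf_{e\in E}\zeta\cdot e\ge\inf_{x\in D}\zeta\cdot x\}$. The directional derivative with respect to $\zeta$ of a set-valued $f$ at $x_0$ in direction $v$ is $f'_\zeta(x_0)(v)=\lim_{s\to0^+}\frac1s\big(f(x_0+sv)-_\zeta f(x_0)\big)$, and $\widehat J'_\zeta(0;M)(v)$ is this derivative for $f=\widehat J(\cdot;M)$, $x_0=0$. Here for a sequence of sets $\lim_{k\to\infty}D_k=\{z\in\mathbb{R}^d\mid \exists z_k\in D_k\ (k\in\mathbb{N}),\ z_k\to z\}$, and $\lim_{s\to0^+}D_s$ is the set equal to $\lim_{k\to\infty}D_{s_k}$ for every sequence $s_k\to0$, $s_k>0$. *)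

theory Defs
  imports "HOL-Analysis.Analysis"
begin

section \<open>Sobolev spaces on a compact interval\<close>

text \<open>
  An element of $W^{1,q}([a,b];R^n)$ is represented by a function on the reals that is continuous
  on $[a,b]$; its values outside $[a,b]$ are irrelevant, as everything below depends only on the
  restriction to $[a,b]$.
\<close>

definition Lq :: "real \<Rightarrow> real \<Rightarrow> real \<Rightarrow> (real \<Rightarrow> real ^ 'n) set" where
  "Lq q a b = {f. f \<in> borel_measurable (lebesgue_on {a..b}) \<and>
                  integrable (lebesgue_on {a..b}) (\<lambda>t. norm (f t) powr q)}"

text \<open>Test functions are the compactly supported continuously differentiable functions on $(a,b)$.\<close>

definition has_weak_deriv :: "real \<Rightarrow> real \<Rightarrow> (real \<Rightarrow> real ^ 'n) \<Rightarrow> (real \<Rightarrow> real ^ 'n) \<Rightarrow> bool" where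
  "has_weak_deriv a b y g \<longleftrightarrow>
     (\<forall>\<phi> \<phi>' :: real \<Rightarrow> real.
        (\<forall>t. (\<phi> has_real_derivative \<phi>' t) (at t)) \<and> continuous_on UNIV \<phi>' \<and>
        closure {t. \<phi> t \<noteq> 0} \<subseteq> {a<..<b} \<longrightarrow>
        (LINT t|lebesgue_on {a..b}. \<phi>' t *\<^sub>R y t) = - (LINT t|lebesgue_on {a..b}. \<phi> t *\<^sub>R g t))"

definition W1q :: "real \<Rightarrow> real \<Rightarrow> real \<Rightarrow> (real \<Rightarrow> real ^ 'n) set" where
  "W1q q a b = {y. continuous_on {a..b} y \<and> y \<in> Lq q a b \<and> (\<exists>g \<in> Lq q a b. has_weak_deriv a b y g)}"

text \<open>A choice of the weak derivative, which is unique up to null subsets of $[a,b]$.\<close>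

definition wderiv :: "real \<Rightarrow> real \<Rightarrow> (real \<Rightarrow> real ^ 'n) \<Rightarrow> real \<Rightarrow> real ^ 'n" where
  "wderiv a b y = (SOME g. integrable (lebesgue_on {a..b}) g \<and> has_weak_deriv a b y g)"

definition W1q_norm :: "real \<Rightarrow> real \<Rightarrow> real \<Rightarrow> (real \<Rightarrow> real ^ 'n) \<Rightarrow> real" where
  "W1q_norm q a b y =
     (LINT t|lebesgue_on {a..b}. norm (y t) powr q) powr (1 / q) +
     (LINT t|lebesgue_on {a..b}. norm (wderiv a b y t) powr q) powr (1 / q)"

definition W1q_0 :: "real \<Rightarrow> real \<Rightarrow> real \<Rightarrow> (real \<Rightarrow> real ^ 'n) set" where
  "W1q_0 q a b = {v \<in> W1q q a b. v a = 0 \<and> v b = 0}"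

text \<open>
  Frechet differentiability at 0 of an extended-real-valued function on $W^{1,q}_0$. The estimate
  is read in the extended reals, so it forces \<open>f\<close> to be finite near 0.
\<close>

definition has_frechet_deriv_at_0 ::
  "real \<Rightarrow> real \<Rightarrow> real \<Rightarrow> ((real \<Rightarrow> real ^ 'n) \<Rightarrow> ereal) \<Rightarrow> ((real \<Rightarrow> real ^ 'n) \<Rightarrow> real) \<Rightarrow> bool" where
  "has_frechet_deriv_at_0 q a b f \<xi> \<longleftrightarrow>
     (\<forall>u \<in> W1q_0 q a b. \<forall>v \<in> W1q_0 q a b. \<xi> (\<lambda>t. u t + v t) = \<xi> u + \<xi> v) \<and>
     (\<forall>c. \<forall>v \<in> W1q_0 q a b. \<xi> (\<lambda>t. c *\<^sub>R v t) = c * \<xi> v) \<and>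
     (\<exists>K. \<forall>v \<in> W1q_0 q a b. \<bar>\<xi> v\<bar> \<le> K * W1q_norm q a b v) \<and>
     \<bar>f (\<lambda>_. 0)\<bar> \<noteq> \<infinity> \<and>
     (\<forall>e>0. \<exists>\<delta>>0. \<forall>v \<in> W1q_0 q a b. W1q_norm q a b v < \<delta> \<longrightarrow>
        \<bar>f v - f (\<lambda>_. 0) - ereal (\<xi> v)\<bar> \<le> ereal (e * W1q_norm q a b v))"

definition frechet_differentiable_at_0 ::
  "real \<Rightarrow> real \<Rightarrow> real \<Rightarrow> ((real \<Rightarrow> real ^ 'n) \<Rightarrow> ereal) \<Rightarrow> bool" where
  "frechet_differentiable_at_0 q a b f \<longleftrightarrow> (\<exists>\<xi>. has_frechet_deriv_at_0 q a b f \<xi>)"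

text \<open>The derivative is determined on $W^{1,q}_0$ only, hence a choice.\<close>

definition frechet_deriv_at_0 ::
  "real \<Rightarrow> real \<Rightarrow> real \<Rightarrow> ((real \<Rightarrow> real ^ 'n) \<Rightarrow> ereal) \<Rightarrow> (real \<Rightarrow> real ^ 'n) \<Rightarrow> real" where
  "frechet_deriv_at_0 q a b f = (SOME \<xi>. has_frechet_deriv_at_0 q a b f \<xi>)"


section \<open>Functions of class $C^1$ and gradients\<close>

text \<open>On a set that is not open, derivatives are taken within the set (one-sided at its boundary).\<close>

definition C1_on :: "'a::real_normed_vector set \<Rightarrow> ('a \<Rightarrow> 'b::real_normed_vector) \<Rightarrow> bool" where
  "C1_on S f \<longleftrightarrow>
     (\<exists>f' :: 'a \<Rightarrow> 'a \<Rightarrow>\<^sub>L 'b. (\<forall>x\<in>S. (f has_derivative blinfun_apply (f' x)) (at x within S)) \<and>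
                        continuous_on S f')"

definition grad :: "('a::real_inner \<Rightarrow> real) \<Rightarrow> 'a \<Rightarrow> 'a" where
  "grad f x = (THE D. GDERIV f x :> D)"


section \<open>Convex cones, set differences and set limits\<close>

definition dual_cone :: "'a::real_inner set \<Rightarrow> 'a set" where
  "dual_cone C = {\<zeta>. \<forall>z\<in>C. \<zeta> \<bullet> z \<ge> 0}"

definition Hplus :: "'a::real_inner \<Rightarrow> 'a set" where
  "Hplus \<zeta> = {z. \<zeta> \<bullet> z \<ge> 0}"

definition S_map :: "('v \<Rightarrow> real) \<Rightarrow> 'a::real_inner \<Rightarrow> 'v \<Rightarrow> 'a set" where
  "S_map \<xi> \<zeta> v = {z. \<zeta> \<bullet> z \<ge> \<xi> v}"

definition cl_co :: "'a::real_normed_vector set \<Rightarrow> 'a set" where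
  "cl_co D = closure (convex hull D)"

definition zeta_diff :: "'a::real_inner \<Rightarrow> 'a set \<Rightarrow> 'a set \<Rightarrow> 'a set" where
  "zeta_diff \<zeta> D E = {z. (\<lambda>e. z + e) ` E \<subseteq> closure {x + h | x h. x \<in> D \<and> h \<in> Hplus \<zeta>}}"

definition set_seq_lim :: "(nat \<Rightarrow> 'a::topological_space set) \<Rightarrow> 'a set" where
  "set_seq_lim D = {z. \<exists>zs. (\<forall>k. zs k \<in> D k) \<and> zs \<longlonglongrightarrow> z}"

definition has_set_lim_at_right_0 :: "(real \<Rightarrow> 'a::topological_space set) \<Rightarrow> 'a set \<Rightarrow> bool" where
  "has_set_lim_at_right_0 D l \<longleftrightarrow>
     (\<forall>s. (\<forall>k. s k > 0) \<and> s \<longlonglongrightarrow> 0 \<longrightarrow> set_seq_lim (\<lambda>k. D (s k)) = l)"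

text \<open>
  \<open>has_zeta_deriv \<zeta> f x0 v l\<close>: the directional derivative of \<open>f\<close> with respect to \<open>\<zeta>\<close> at \<open>x0\<close> in
  direction \<open>v\<close> exists and equals \<open>l\<close>.
\<close>

definition has_zeta_deriv ::
  "'a::real_inner \<Rightarrow> ((real \<Rightarrow> real ^ 'n) \<Rightarrow> 'a set) \<Rightarrow> (real \<Rightarrow> real ^ 'n) \<Rightarrow>
   (real \<Rightarrow> real ^ 'n) \<Rightarrow> 'a set \<Rightarrow> bool" where
  "has_zeta_deriv \<zeta> f x0 v l \<longleftrightarrow>
     has_set_lim_at_right_0
       (\<lambda>s. (\<lambda>z. (1 / s) *\<^sub>R z) ` zeta_diff \<zeta> (f (\<lambda>t. x0 t + s *\<^sub>R v t)) (f x0)) l"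


section \<open>The variational problem\<close>

definition X1 :: "real \<Rightarrow> real \<Rightarrow> real \<Rightarrow> real ^ 'n \<Rightarrow> real ^ 'n \<Rightarrow> (real \<Rightarrow> real ^ 'n) set" where
  "X1 q a b A B = {y \<in> W1q q a b. y a = A \<and> y b = B}"

definition J :: "real \<Rightarrow> real \<Rightarrow> (real \<Rightarrow> real ^ 'n \<Rightarrow> real ^ 'n \<Rightarrow> real ^ 'd) \<Rightarrow>
                 (real \<Rightarrow> real ^ 'n) \<Rightarrow> real ^ 'd" where
  "J a b L y = (LINT t|lebesgue_on {a..b}. L t (y t) (wderiv a b y t))"

definition Jbar :: "real \<Rightarrow> real \<Rightarrow> (real \<Rightarrow> real ^ 'n \<Rightarrow> real ^ 'n \<Rightarrow> real ^ 'd) \<Rightarrow>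
                    (real ^ 'd) set \<Rightarrow> (real \<Rightarrow> real ^ 'n) \<Rightarrow> (real ^ 'd) set" where
  "Jbar a b L C y = (\<lambda>c. J a b L y + c) ` C"

definition Jzeta :: "real \<Rightarrow> real \<Rightarrow> (real \<Rightarrow> real ^ 'n \<Rightarrow> real ^ 'n \<Rightarrow> real ^ 'd) \<Rightarrow>
                     real ^ 'd \<Rightarrow> (real \<Rightarrow> real ^ 'n) \<Rightarrow> real" where
  "Jzeta a b L \<zeta> y = \<zeta> \<bullet> J a b L y"

definition infimizer ::
  "real \<Rightarrow> real \<Rightarrow> real \<Rightarrow> real ^ 'n \<Rightarrow> real ^ 'n \<Rightarrow> (real \<Rightarrow> real ^ 'n \<Rightarrow> real ^ 'n \<Rightarrow> real ^ 'd) \<Rightarrow>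
   (real ^ 'd) set \<Rightarrow> (real \<Rightarrow> real ^ 'n) set \<Rightarrow> bool" where
  "infimizer q a b A B L C M \<longleftrightarrow>
     M \<subseteq> X1 q a b A B \<and>
     cl_co (\<Union>y\<in>M. Jbar a b L C y) = cl_co (\<Union>y\<in>X1 q a b A B. Jbar a b L C y)"

definition zeta_solution ::
  "real \<Rightarrow> real \<Rightarrow> real \<Rightarrow> real ^ 'n \<Rightarrow> real ^ 'n \<Rightarrow> (real \<Rightarrow> real ^ 'n \<Rightarrow> real ^ 'n \<Rightarrow> real ^ 'd) \<Rightarrow>
   real ^ 'd \<Rightarrow> (real \<Rightarrow> real ^ 'n) \<Rightarrow> bool" where
  "zeta_solution q a b A B L \<zeta> y \<longleftrightarrow>
     y \<in> X1 q a b A B \<and>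
     ereal (Jzeta a b L \<zeta> y) = (INF u \<in> X1 q a b A B. ereal (Jzeta a b L \<zeta> u))"

definition Jhat ::
  "real \<Rightarrow> real \<Rightarrow> (real \<Rightarrow> real ^ 'n \<Rightarrow> real ^ 'n \<Rightarrow> real ^ 'd) \<Rightarrow> (real ^ 'd) set \<Rightarrow>
   (real \<Rightarrow> real ^ 'n) set \<Rightarrow> (real \<Rightarrow> real ^ 'n) \<Rightarrow> (real ^ 'd) set" where
  "Jhat a b L C M v = cl_co (\<Union>y\<in>M. Jbar a b L C (\<lambda>t. y t + v t))"

definition phi ::
  "real \<Rightarrow> real \<Rightarrow> (real \<Rightarrow> real ^ 'n \<Rightarrow> real ^ 'n \<Rightarrow> real ^ 'd) \<Rightarrow> (real ^ 'd) set \<Rightarrow> real ^ 'd \<Rightarrow>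
   (real \<Rightarrow> real ^ 'n) set \<Rightarrow> (real \<Rightarrow> real ^ 'n) \<Rightarrow> ereal" where
  "phi a b L C \<zeta> M v = (INF z \<in> Jhat a b L C M v. ereal (\<zeta> \<bullet> z))"

end

theory Submission
  imports Defs
begin

text \<open>
  For $y\in M$ and $v\in W^{1,q}_0$ the arc $y+v$ is again admissible, so
  $\varphi_{\zeta,M}(v)\ge J_\zeta(y_\zeta)=\varphi_{\zeta,M}(0)$, while
  $\varphi_{\zeta,M}(v)\le J_\zeta(y_\zeta+v)$ because $y_\zeta\in M$. The growth conditions make
  $J_\zeta$ Frechet differentiable at $y_\zeta$, and its derivative vanishes on $W^{1,q}_0$ by
  minimality. Hence $0\le\varphi_{\zeta,M}(v)-\varphi_{\zeta,M}(0)\le o(\|v\|)$, which gives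
  $\varphi'_{\zeta,M}(0)=0$; the difference quotients of $\widehat J(\cdot;M)$ are the halfspaces
  $\{z\mid\zeta\cdot z\ge(\varphi_{\zeta,M}(sv)-\varphi_{\zeta,M}(0))/s\}$ and tend to $H^+(\zeta)$.
\<close>

section \<open>Halfspaces as $\zeta$-differences and set limits\<close>

text \<open>The obstacle is the differentiability of J_\<zeta> on W^{1,q}: an increment that is
  small in L^q need not be small pointwise, so the pointwise expansion of the integrand gives no
  uniform estimate by itself. The quotient |R|/|w| of the remainder is therefore measured in L^p
  with 1/p + 1/q = 1. Gradient growth of order q - 1 makes the p-th power of this quotient grow like
  |w|^q, and Young's inequality with a free weight then plays the role of Hoelder's inequality. Two
  uses of \<open>SOME\<close> cost extra work. The weak derivative is a choice, so it is additive
  and homogeneous only almost everywhere, and that rests on the uniqueness of weak derivatives, i.e.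
  on the fundamental lemma of the calculus of variations. The Frechet derivative is a choice as
  well, so its value on W_0^{1,q} is known only through a uniqueness argument. Of the first
  variation, homogeneity suffices: being nonnegative at v and at -v it vanishes, and the derivative
  of \<phi> is the zero functional.\<close>

lemma closure_superset_halfspace:
  fixes \<zeta> :: "'a::real_inner"
  assumes "\<zeta> \<noteq> 0" and "\<And>z. \<zeta> \<bullet> z > r \<Longrightarrow> z \<in> S" and "\<zeta> \<bullet> z \<ge> r"
  shows "z \<in> closure S"
proof -
  have pos: "\<zeta> \<bullet> \<zeta> > 0"
    using assms(1) by simp
  have "(\<lambda>k. z + (1 / real (Suc k)) *\<^sub>R \<zeta>) \<longlonglongrightarrow> z + 0 *\<^sub>R \<zeta>"
    by (intro tendsto_intros LIMSEQ_Suc lim_inverse_n' [unfolded inverse_eq_divide])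
  moreover have "z + (1 / real (Suc k)) *\<^sub>R \<zeta> \<in> S" for k
  proof (rule assms(2))
    have "(1 / real (Suc k)) * (\<zeta> \<bullet> \<zeta>) > 0"
      using pos by simp
    then show "r < \<zeta> \<bullet> (z + (1 / real (Suc k)) *\<^sub>R \<zeta>)"
      using assms(3) by (simp add: inner_right_distrib)
  qed
  ultimately show ?thesis
    unfolding closure_sequential by (intro exI[of _ "\<lambda>k. z + (1 / real (Suc k)) *\<^sub>R \<zeta>"]) auto
qed

text \<open>The sum is the closed halfspace if the infimum is attained and the open one otherwise;
  the closure removes the distinction. A finite infimum also forces \<open>D\<close> to be
  nonempty.\<close>

lemma closure_add_Hplus:
  fixes \<zeta> :: "'a::real_inner"
  assumes "\<zeta> \<noteq> 0" and inf: "(INF z \<in> D. ereal (\<zeta> \<bullet> z)) = ereal r"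
  shows "closure {x + h | x h. x \<in> D \<and> h \<in> Hplus \<zeta>} = {z. \<zeta> \<bullet> z \<ge> r}"
proof
  have ge: "\<zeta> \<bullet> x \<ge> r" if "x \<in> D" for x
    using INF_lower[OF that, of "\<lambda>z. ereal (\<zeta> \<bullet> z)"] inf by simp
  show "closure {x + h | x h. x \<in> D \<and> h \<in> Hplus \<zeta>} \<subseteq> {z. \<zeta> \<bullet> z \<ge> r}"
    by (rule closure_minimal)
       (auto simp: Hplus_def inner_right_distrib closed_halfspace_ge dest: ge intro: add_increasing2)
  show "{z. \<zeta> \<bullet> z \<ge> r} \<subseteq> closure {x + h | x h. x \<in> D \<and> h \<in> Hplus \<zeta>}"
  proof
    fix z assume z: "z \<in> {z. \<zeta> \<bullet> z \<ge> r}"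
    show "z \<in> closure {x + h | x h. x \<in> D \<and> h \<in> Hplus \<zeta>}"
    proof (rule closure_superset_halfspace[OF assms(1), of r])
      fix w assume "\<zeta> \<bullet> w > r"
      then have "(INF z \<in> D. ereal (\<zeta> \<bullet> z)) < ereal (\<zeta> \<bullet> w)"
        using inf by simp
      then obtain x where x: "x \<in> D" "\<zeta> \<bullet> x < \<zeta> \<bullet> w"
        by (auto simp: INF_less_iff)
      then have "w = x + (w - x)" "w - x \<in> Hplus \<zeta>"
        by (auto simp: Hplus_def inner_diff_right)
      with x(1) show "w \<in> {x + h | x h. x \<in> D \<and> h \<in> Hplus \<zeta>}"
        by blast
    qed (use z in simp)
  qed
qed

lemma zeta_diff_eq_halfspace:
  fixes \<zeta> :: "'a::real_inner"
  assumes "\<zeta> \<noteq> 0"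
    and D: "(INF z \<in> D. ereal (\<zeta> \<bullet> z)) = ereal r"
    and E: "(INF z \<in> E. ereal (\<zeta> \<bullet> z)) = ereal s"
  shows "zeta_diff \<zeta> D E = {z. \<zeta> \<bullet> z \<ge> r - s}"
proof -
  have "(\<forall>e\<in>E. r \<le> \<zeta> \<bullet> z + \<zeta> \<bullet> e) \<longleftrightarrow> r - s \<le> \<zeta> \<bullet> z" for z
  proof -
    have "(\<forall>e\<in>E. r \<le> \<zeta> \<bullet> z + \<zeta> \<bullet> e) \<longleftrightarrow> (\<forall>e\<in>E. ereal (r - \<zeta> \<bullet> z) \<le> ereal (\<zeta> \<bullet> e))"
      by (auto simp: algebra_simps)
    also have "\<dots> \<longleftrightarrow> ereal (r - \<zeta> \<bullet> z) \<le> ereal s"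
      by (simp add: le_INF_iff flip: E)
    finally show ?thesis
      by auto
  qed
  then show ?thesis
    by (auto simp: zeta_diff_def closure_add_Hplus[OF assms(1) D] image_subset_iff inner_right_distrib)
qed

lemma scaleR_image_halfspace:
  fixes \<zeta> :: "'a::real_inner"
  assumes "s > 0"
  shows "(\<lambda>z. (1 / s) *\<^sub>R z) ` {z. \<zeta> \<bullet> z \<ge> r} = {z. \<zeta> \<bullet> z \<ge> r / s}"
proof (intro set_eqI iffI)
  fix z assume "z \<in> {z. \<zeta> \<bullet> z \<ge> r / s}"
  then have "s *\<^sub>R z \<in> {z. \<zeta> \<bullet> z \<ge> r}"
    using assms by (simp add: divide_simps mult.commute)
  then show "z \<in> (\<lambda>z. (1 / s) *\<^sub>R z) ` {z. \<zeta> \<bullet> z \<ge> r}"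
    using assms by (intro image_eqI[of _ _ "s *\<^sub>R z"]) auto
qed (use assms in \<open>auto simp: divide_right_mono\<close>)

lemma set_seq_lim_halfspaces:
  fixes \<zeta> :: "'a::real_inner"
  assumes "\<zeta> \<noteq> 0" and c: "c \<longlonglongrightarrow> c0"
  shows "set_seq_lim (\<lambda>k. {z. \<zeta> \<bullet> z \<ge> c k}) = {z. \<zeta> \<bullet> z \<ge> c0}"
proof (intro set_eqI iffI)
  fix z assume "z \<in> set_seq_lim (\<lambda>k. {z. \<zeta> \<bullet> z \<ge> c k})"
  then obtain zs where zs: "\<And>k. \<zeta> \<bullet> zs k \<ge> c k" "zs \<longlonglongrightarrow> z"
    by (auto simp: set_seq_lim_def)
  have "(\<lambda>k. \<zeta> \<bullet> zs k) \<longlonglongrightarrow> \<zeta> \<bullet> z"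
    by (intro tendsto_intros zs)
  then show "z \<in> {z. \<zeta> \<bullet> z \<ge> c0}"
    using LIMSEQ_le[OF c] zs(1) by auto
next
  fix z assume z: "z \<in> {z. \<zeta> \<bullet> z \<ge> c0}"
  \<comment> \<open>The multiple of \<zeta> is chosen to change \<zeta> \<bullet> z by exactly
    \<open>c k - c0\<close>, so the point meets the k-th constraint while the correction tends to
    0.\<close>
  define zs where "zs k = z + ((c k - c0) / (\<zeta> \<bullet> \<zeta>)) *\<^sub>R \<zeta>" for k
  have "zs \<longlonglongrightarrow> z + ((c0 - c0) / (\<zeta> \<bullet> \<zeta>)) *\<^sub>R \<zeta>"
    unfolding zs_def by (intro tendsto_intros c) (use assms in auto)
  moreover have "\<zeta> \<bullet> zs k \<ge> c k" for k
    using z assms(1) by (simp add: zs_def inner_right_distrib)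
  ultimately show "z \<in> set_seq_lim (\<lambda>k. {z. \<zeta> \<bullet> z \<ge> c k})"
    by (auto simp: set_seq_lim_def)
qed


section \<open>A remainder estimate in $L^q$\<close>

text \<open>The sum is at most three times its largest term. Unlike a convexity argument this also
  covers exponents below 1, and q - 1 may be such an exponent. Sums of two terms are the case
  \<open>z = 0\<close>.\<close>

lemma powr_add3_le:
  fixes x y z p :: real
  assumes "x \<ge> 0" "y \<ge> 0" "z \<ge> 0" "p \<ge> 0"
  shows "(x + y + z) powr p \<le> 3 powr p * (x powr p + y powr p + z powr p)"
proof -
  define m where "m = max x (max y z)"
  have "(x + y + z) powr p \<le> (3 * m) powr p"
    using assms by (intro powr_mono2) (auto simp: m_def)
  also have "\<dots> = 3 powr p * m powr p"
    using assms by (intro powr_mult)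
  also have "m powr p \<le> x powr p + y powr p + z powr p"
    by (auto simp: m_def max_def)
  finally show ?thesis
    by simp
qed

lemma tendsto_0_if_powr_tendsto_0:
  fixes f :: "'a \<Rightarrow> real"
  assumes "((\<lambda>x. f x powr q) \<longlongrightarrow> 0) F" "q > 0" "\<And>x. f x \<ge> 0"
  shows "(f \<longlongrightarrow> 0) F"
proof -
  have "((\<lambda>x. (f x powr q) powr (1 / q)) \<longlongrightarrow> 0) F"
    using assms(2) by (intro tendsto_zero_powrI[OF assms(1) tendsto_const]) simp_all
  moreover have "(f x powr q) powr (1 / q) = f x" for x
    using assms(2,3) by (simp add: powr_powr)
  ultimately show ?thesis
    by simp
qed

text \<open>\<open>R\<close> stands for a first-order remainder. The exponent in
  \<open>bound\<close> is conjugate to q: along z in L^q the quotient |R|/|w| lies in L^p. At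
  \<open>w = 0\<close> the quotient is 0, by division by zero.\<close>

locale Lq_remainder =
  fixes M :: "'a measure" and q K :: real and H :: "'a \<Rightarrow> real"
    and R :: "'a \<Rightarrow> 'z::{real_normed_vector, second_countable_topology} \<Rightarrow> real"
  assumes q: "1 < q" and K: "0 \<le> K" and H: "integrable M H"
    and meas: "\<And>z. z \<in> borel_measurable M \<Longrightarrow> (\<lambda>t. R t (z t)) \<in> borel_measurable M"
    and R0: "\<And>t. t \<in> space M \<Longrightarrow> R t 0 = 0"
    and bound: "\<And>t w. t \<in> space M \<Longrightarrow>
      (\<bar>R t w\<bar> / norm w) powr (q / (q - 1)) \<le> H t + K * norm w powr q"
    and diff: "\<And>t. t \<in> space M \<Longrightarrow> ((\<lambda>w. R t w / norm w) \<longlongrightarrow> 0) (at 0)"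
begin

definition "p = q / (q - 1)"

lemma p: "1 < p" "1 / p + 1 / q = 1"
  using q by (auto simp: p_def field_simps)

text \<open>Young's inequality for the product $(\mu|R|/|w|)\cdot(|w|/\mu d)$.\<close>

lemma abs_le_Young:
  assumes "t \<in> space M" "d > 0" "\<mu> > 0"
  shows "\<bar>R t w\<bar> \<le> d * (\<mu> powr p * (\<bar>R t w\<bar> / norm w) powr p / p
            + norm w powr q / ((\<mu> * d) powr q * q))"
proof (cases "w = 0")
  case True
  then show ?thesis
    using R0 assms p q by simp
next
  case False
  have "(\<mu> * (\<bar>R t w\<bar> / norm w)) * (norm w / (\<mu> * d))
      \<le> (\<mu> * (\<bar>R t w\<bar> / norm w)) powr p / p + (norm w / (\<mu> * d)) powr q / q"
    using assms by (intro Youngs_inequality p q) auto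
  then have "\<bar>R t w\<bar> / d \<le> \<mu> powr p * (\<bar>R t w\<bar> / norm w) powr p / p
            + norm w powr q / ((\<mu> * d) powr q * q)"
    using assms False by (simp add: powr_mult powr_divide)
  then show ?thesis
    using assms by (simp add: pos_divide_le_eq mult.commute)
qed

lemma integrable_R:
  assumes "z \<in> borel_measurable M" "integrable M (\<lambda>t. norm (z t) powr q)"
  shows "integrable M (\<lambda>t. R t (z t))"
proof (rule Bochner_Integration.integrable_bound[OF _ meas[OF assms(1)]])
  show "integrable M (\<lambda>t. (H t + K * norm (z t) powr q) / p + norm (z t) powr q / q)"
    using H assms by auto
  show "AE t in M. norm (R t (z t)) \<le> norm ((H t + K * norm (z t) powr q) / p + norm (z t) powr q / q)"
  proof (rule AE_I2)
    fix t assume t: "t \<in> space M"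
    have "(\<bar>R t (z t)\<bar> / norm (z t)) powr p / p \<le> (H t + K * norm (z t) powr q) / p"
      using p(1) by (intro divide_right_mono bound[OF t, folded p_def]) auto
    \<comment> \<open>Integrability asks for no small constant, so both weights in Young's
      inequality are 1.\<close>
    with abs_le_Young[OF t, of 1 1 "z t"]
    have "\<bar>R t (z t)\<bar> \<le> (H t + K * norm (z t) powr q) / p + norm (z t) powr q / q"
      by simp
    then show "norm (R t (z t)) \<le> norm ((H t + K * norm (z t) powr q) / p + norm (z t) powr q / q)"
      by simp
  qed
qed

text \<open>Subtracting $K|z_k|^q$ leaves a function dominated by $|H|$, so dominated convergence needs no
  common majorant of the $z_k$.\<close>

lemma truncated_quotient_tendsto:
  assumes z: "\<And>k. z k \<in> borel_measurable M"
    and int: "\<And>k. integrable M (\<lambda>t. norm (z k t) powr q)"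
    and lim: "AE t in M. (\<lambda>k. norm (z k t) powr q) \<longlonglongrightarrow> 0"
  defines "m \<equiv> \<lambda>k t. max 0 ((\<bar>R t (z k t)\<bar> / norm (z k t)) powr p - K * norm (z k t) powr q)"
  shows "integrable M (m k)" "(\<lambda>k. LINT t|M. m k t) \<longlonglongrightarrow> 0"
proof -
  have meas_m: "m k \<in> borel_measurable M" for k
    using z[of k] meas[OF z[of k]] unfolding m_def by measurable
  have mH: "norm (m k t) \<le> \<bar>H t\<bar>" if "t \<in> space M" for k t
    using bound[OF that, of "z k t"] by (auto simp: m_def p_def)
  show "integrable M (m k)"
    by (rule Bochner_Integration.integrable_bound[OF integrable_abs[OF H] meas_m]) (use mH in auto)
  have "(\<lambda>k. LINT t|M. m k t) \<longlonglongrightarrow> (LINT t|M. 0)"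
  proof (rule integral_dominated_convergence[OF _ meas_m integrable_abs[OF H]])
    show "AE t in M. (\<lambda>k. m k t) \<longlonglongrightarrow> 0"
      using lim AE_space
    proof eventually_elim
      case (elim t)
      have "(\<lambda>k. norm (z k t)) \<longlonglongrightarrow> 0"
        using q by (intro tendsto_0_if_powr_tendsto_0[OF elim(1)]) auto
      then have z0: "(\<lambda>k. z k t) \<longlonglongrightarrow> 0"
        by (rule tendsto_norm_zero_cancel)
      \<comment> \<open>The quotient has value 0 at 0 by division by zero, which turns the punctured
        limit into continuity; the sequence \<open>z k t\<close> may then take the value 0.\<close>
      have "isCont (\<lambda>w. R t w / norm w) 0"
        using diff[OF elim(2)] by (simp add: isCont_def)
      then have "(\<lambda>k. R t (z k t) / norm (z k t)) \<longlonglongrightarrow> R t 0 / norm (0::'z)"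
        using z0 by (rule isCont_tendsto_compose)
      then have "(\<lambda>k. \<bar>R t (z k t) / norm (z k t)\<bar>) \<longlonglongrightarrow> 0"
        by (intro tendsto_rabs_zero) simp
      then have "(\<lambda>k. (\<bar>R t (z k t)\<bar> / norm (z k t)) powr p) \<longlonglongrightarrow> 0"
        using p(1) by (intro tendsto_zero_powrI[OF _ tendsto_const]) auto
      then have "(\<lambda>k. m k t) \<longlonglongrightarrow> max 0 (0 - K * 0)"
        unfolding m_def by (intro tendsto_intros elim)
      then show ?case
        by simp
    qed
  qed (use mH in auto)
  then show "(\<lambda>k. LINT t|M. m k t) \<longlonglongrightarrow> 0"
    by simp
qed

text \<open>Young's inequality is integrated after bounding the p-th power of the quotient by
  \<open>m t\<close> plus K |z|^q. Its second term carries 1/(\<mu> d)^q, which cancels the bound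
  d^q on the integral; what remains there depends on \<mu> alone and can be made small
  first.\<close>

lemma integral_R_le:
  assumes z: "z \<in> borel_measurable M" and int: "integrable M (\<lambda>t. norm (z t) powr q)"
    and d: "d > 0" "(LINT t|M. norm (z t) powr q) \<le> d powr q" and "\<mu> > 0"
  defines "m \<equiv> \<lambda>t. max 0 ((\<bar>R t (z t)\<bar> / norm (z t)) powr p - K * norm (z t) powr q)"
  assumes m: "integrable M m"
  shows "\<bar>LINT t|M. R t (z t)\<bar>
      \<le> d * (\<mu> powr p * ((LINT t|M. m t) + K * d powr q) / p + 1 / (\<mu> powr q * q))"
proof -
  let ?N = "LINT t|M. norm (z t) powr q"
  have "\<bar>LINT t|M. R t (z t)\<bar> \<le> (LINT t|M. \<bar>R t (z t)\<bar>)"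
    by (rule integral_abs_bound)
  also have "\<dots> \<le> (LINT t|M. d * (\<mu> powr p * (m t + K * norm (z t) powr q) / p
            + norm (z t) powr q / ((\<mu> * d) powr q * q)))"
  proof (rule integral_mono)
    show "integrable M (\<lambda>t. \<bar>R t (z t)\<bar>)"
      using integrable_R[OF z int] by simp
    fix t assume t: "t \<in> space M"
    have "(\<bar>R t (z t)\<bar> / norm (z t)) powr p \<le> m t + K * norm (z t) powr q"
      by (simp add: m_def)
    then have "\<mu> powr p * (\<bar>R t (z t)\<bar> / norm (z t)) powr p / p
        \<le> \<mu> powr p * (m t + K * norm (z t) powr q) / p"
      using p(1) by (intro divide_right_mono mult_left_mono) auto
    then show "\<bar>R t (z t)\<bar> \<le> d * (\<mu> powr p * (m t + K * norm (z t) powr q) / p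
            + norm (z t) powr q / ((\<mu> * d) powr q * q))"
      using d(1) by (intro order.trans[OF abs_le_Young[OF t d(1) \<open>\<mu> > 0\<close>]] mult_left_mono add_mono) auto
  qed (use m int in auto)
  also have "\<dots> = d * (\<mu> powr p * ((LINT t|M. m t) + K * ?N) / p + ?N / ((\<mu> * d) powr q * q))"
    using m int by simp
  also have "\<dots> \<le> d * (\<mu> powr p * ((LINT t|M. m t) + K * d powr q) / p
      + d powr q / ((\<mu> * d) powr q * q))"
    using d K p(1) q by (intro mult_left_mono add_mono divide_right_mono) auto
  also have "d powr q / ((\<mu> * d) powr q * q) = 1 / (\<mu> powr q * q)"
    using d \<open>\<mu> > 0\<close> by (simp add: powr_mult)
  finally show ?thesis .
qed

text \<open>Dominated convergence works along sequences, so a failing \<open>e\<close> is turned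
  into increments \<open>z k\<close> with bounds \<open>d k\<close> below 1/(k + 1). Their q-th
  powers tend to 0 in L^1, hence almost everywhere along a subsequence. The number \<open>d\<close>
  is any positive bound on the L^q norm rather than the norm itself, so division by it is legitimate
  even when z vanishes.\<close>

theorem integral_R_small:
  assumes "0 < e"
  shows "\<exists>\<delta>>0. \<forall>d z. 0 < d \<and> d < \<delta> \<and> z \<in> borel_measurable M \<and>
      integrable M (\<lambda>t. norm (z t) powr q) \<and> (LINT t|M. norm (z t) powr q) \<le> d powr q \<longrightarrow>
      \<bar>LINT t|M. R t (z t)\<bar> \<le> e * d"
proof (rule ccontr)
  assume "\<not> ?thesis"
  then have neg: "\<exists>d z. 0 < d \<and> d < \<delta> \<and> z \<in> borel_measurable M \<and>
      integrable M (\<lambda>t. norm (z t) powr q) \<and> (LINT t|M. norm (z t) powr q) \<le> d powr q \<and>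
      e * d < \<bar>LINT t|M. R t (z t)\<bar>" if "\<delta> > 0" for \<delta>
    using that by (simp add: not_le)
  have "\<forall>k::nat. \<exists>d z. 0 < d \<and> d < 1 / real (Suc k) \<and> z \<in> borel_measurable M \<and>
      integrable M (\<lambda>t. norm (z t) powr q) \<and> (LINT t|M. norm (z t) powr q) \<le> d powr q \<and>
      e * d < \<bar>LINT t|M. R t (z t)\<bar>"
    by (intro allI neg) simp
  then obtain d z where d: "\<And>k. 0 < d k" "\<And>k. d k < 1 / real (Suc k)"
    and z: "\<And>k. z k \<in> borel_measurable M" "\<And>k. integrable M (\<lambda>t. norm (z k t) powr q)"
    and N: "\<And>k. (LINT t|M. norm (z k t) powr q) \<le> d k powr q"
    and big: "\<And>k. e * d k < \<bar>LINT t|M. R t (z k t)\<bar>"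
    unfolding choice_iff by blast
  have d0: "d \<longlonglongrightarrow> 0"
    by (rule real_tendsto_sandwich[OF _ _ tendsto_const LIMSEQ_Suc[OF lim_1_over_n]])
       (use d in \<open>auto intro!: always_eventually intro: less_imp_le\<close>)
  then have dq0: "(\<lambda>k. d k powr q) \<longlonglongrightarrow> 0"
    using q d by (intro tendsto_zero_powrI[OF _ tendsto_const]) (auto intro!: always_eventually intro: less_imp_le)
  have "(\<lambda>k. LINT t|M. norm (norm (z k t) powr q)) \<longlonglongrightarrow> 0"
    by (rule real_tendsto_sandwich[OF _ _ tendsto_const dq0])
       (use N in \<open>auto intro!: always_eventually intro: Bochner_Integration.integral_nonneg\<close>)
  then obtain r where r: "strict_mono r" "AE t in M. (\<lambda>k. norm (z (r k) t) powr q) \<longlonglongrightarrow> 0"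
    using tendsto_L1_AE_subseq[of M "\<lambda>k t. norm (z k t) powr q", OF z(2)] by blast
  define m where "m k t = max 0 ((\<bar>R t (z (r k) t)\<bar> / norm (z (r k) t)) powr p
      - K * norm (z (r k) t) powr q)" for k t
  have m: "integrable M (m k)" "(\<lambda>k. LINT t|M. m k t) \<longlonglongrightarrow> 0" for k
    using truncated_quotient_tendsto[of "\<lambda>k. z (r k)", OF z(1) z(2) r(2)]
    unfolding m_def[abs_def] by auto
  \<comment> \<open>The weight that makes the \<mu>-only term equal to e / 2; the other term tends
    to 0 for this fixed \<mu>, which contradicts the lower bound e.\<close>
  define \<mu> where "\<mu> = (2 / (q * e)) powr (1 / q)"
  have \<mu>: "\<mu> > 0" "1 / (\<mu> powr q * q) = e / 2"
    using q \<open>0 < e\<close> by (auto simp: \<mu>_def powr_powr)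
  have "e \<le> \<mu> powr p * ((LINT t|M. m k t) + K * d (r k) powr q) / p + e / 2" for k
  proof -
    have "e * d (r k) \<le> d (r k) * (\<mu> powr p * ((LINT t|M. m k t) + K * d (r k) powr q) / p + e / 2)"
      using integral_R_le[OF z(1,2) d(1) N \<mu>(1), of "r k"] m(1)[of k] big[of "r k"]
      unfolding m_def[abs_def] \<mu>(2) by linarith
    then show ?thesis
      using d(1)[of "r k"] by (simp add: mult.commute[of e])
  qed
  moreover have "(\<lambda>k. \<mu> powr p * ((LINT t|M. m k t) + K * d (r k) powr q) / p + e / 2)
      \<longlonglongrightarrow> \<mu> powr p * (0 + K * 0) / p + e / 2"
    using p(1) by (intro tendsto_intros m LIMSEQ_subseq_LIMSEQ[OF dq0 r(1), unfolded o_def]) auto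
  ultimately have "e \<le> \<mu> powr p * (0 + K * 0) / p + e / 2"
    by (intro LIMSEQ_le_const) auto
  then show False
    using \<open>0 < e\<close> by simp
qed

end


section \<open>Uniqueness of weak derivatives\<close>

text \<open>Squaring removes the kink of the positive part: the difference quotient at 0 is again
  \<open>max 0 h\<close>.\<close>

lemma has_real_derivative_max0_square:
  "((\<lambda>x::real. (max 0 x)\<^sup>2) has_real_derivative 2 * max 0 x) (at x)"
proof -
  consider "x < 0" | "x = 0" | "x > 0" by linarith
  then show ?thesis
  proof cases
    case 1
    then have "eventually (\<lambda>y. y < 0) (nhds x)"
      by (intro eventually_nhds_in_open[of "{..<0}", simplified]) auto
    then have ev: "eventually (\<lambda>y. (max 0 y)\<^sup>2 = (0::real)) (nhds x)"
      by eventually_elim auto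
    have "((\<lambda>x. 0) has_real_derivative 2 * max 0 x) (at x)"
      using 1 by (auto intro!: derivative_eq_intros)
    then show ?thesis
      by (rule iffD2[OF DERIV_cong_ev[OF refl ev refl]])
  next
    case 3
    then have "eventually (\<lambda>y. y > 0) (nhds x)"
      by (intro eventually_nhds_in_open[of "{0<..}", simplified]) auto
    then have ev: "eventually (\<lambda>y. (max 0 y)\<^sup>2 = (y::real)\<^sup>2) (nhds x)"
      by eventually_elim auto
    have "((\<lambda>x. x\<^sup>2) has_real_derivative 2 * max 0 x) (at x)"
      using 3 by (auto intro!: derivative_eq_intros)
    then show ?thesis
      by (rule iffD2[OF DERIV_cong_ev[OF refl ev refl]])
  next
    case 2
    have "((\<lambda>h::real. max 0 h) \<longlongrightarrow> max 0 0) (at 0)"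
      by (intro tendsto_intros)
    moreover have "(max 0 h)\<^sup>2 / h = max 0 h" for h :: real
      by (auto simp: max_def power2_eq_square)
    ultimately show ?thesis
      using 2 by (simp add: DERIV_def)
  qed
qed

text \<open>The bump $\varphi/(\varphi+\varepsilon)$ with $\varphi(t)=\max(0,(t-c)(d-t))^2$ converges to the
  indicator of $(c,d)$ as $\varepsilon\to0$.\<close>

definition bump :: "real \<Rightarrow> real \<Rightarrow> real \<Rightarrow> real \<Rightarrow> real" where
  "bump c d \<epsilon> t = (max 0 ((t - c) * (d - t)))\<^sup>2 / ((max 0 ((t - c) * (d - t)))\<^sup>2 + \<epsilon>)"

lemma bump_C1:
  assumes "\<epsilon> > 0"
  obtains \<phi>' where "\<And>t. (bump c d \<epsilon> has_real_derivative \<phi>' t) (at t)" "continuous_on UNIV \<phi>'"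
proof
  define u where "u t = (t - c) * (d - t)" for t
  define \<phi> where "\<phi> t = (max 0 (u t))\<^sup>2" for t
  define \<phi>' where "\<phi>' t = 2 * max 0 (u t) * ((d - t) - (t - c))" for t
  have nz: "\<phi> t + \<epsilon> \<noteq> 0" for t
    using assms by (smt (verit) \<phi>_def zero_le_power2)
  have du: "(u has_real_derivative ((d - t) - (t - c))) (at t)" for t
    unfolding u_def by (auto intro!: derivative_eq_intros)
  have d\<phi>: "(\<phi> has_real_derivative \<phi>' t) (at t)" for t
    unfolding \<phi>_def \<phi>'_def by (rule DERIV_chain2[OF has_real_derivative_max0_square du])
  have "bump c d \<epsilon> = (\<lambda>t. \<phi> t / (\<phi> t + \<epsilon>))"
    by (auto simp: bump_def \<phi>_def u_def)
  then show "(bump c d \<epsilon> has_real_derivative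
       (\<phi>' t * (\<phi> t + \<epsilon>) - \<phi> t * \<phi>' t) / ((\<phi> t + \<epsilon>) * (\<phi> t + \<epsilon>))) (at t)" for t
    using nz by (auto intro!: derivative_eq_intros d\<phi>)
  have [continuous_intros]: "continuous_on UNIV \<phi>" "continuous_on UNIV \<phi>'"
    unfolding \<phi>_def \<phi>'_def u_def by (intro continuous_intros)+
  show "continuous_on UNIV (\<lambda>t. (\<phi>' t * (\<phi> t + \<epsilon>) - \<phi> t * \<phi>' t) / ((\<phi> t + \<epsilon>) * (\<phi> t + \<epsilon>)))"
    using nz by (intro continuous_intros) auto
qed

lemma bump_support:
  assumes "c < d"
  shows "closure {t. bump c d \<epsilon> t \<noteq> 0} \<subseteq> {c..d}"
proof (rule closure_minimal)
  show "{t. bump c d \<epsilon> t \<noteq> 0} \<subseteq> {c..d}"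
  proof
    fix t assume "t \<in> {t. bump c d \<epsilon> t \<noteq> 0}"
    then have "\<not> (t - c) * (d - t) \<le> 0"
      by (auto simp: bump_def max_absorb1)
    then have "(t - c) * (d - t) > 0"
      by linarith
    then show "t \<in> {c..d}"
      using assms by (auto simp: zero_less_mult_iff)
  qed
qed auto

lemma bump_bounds:
  assumes "\<epsilon> > 0"
  shows "0 \<le> bump c d \<epsilon> t" "bump c d \<epsilon> t \<le> 1"
  using assms by (auto simp: bump_def divide_simps add_nonneg_pos)

lemma bump_tendsto_indicator:
  assumes "\<And>k. c < c' k" "\<And>k. c' k < d' k" "\<And>k. d' k < d"
    and lim: "c' \<longlonglongrightarrow> c" "d' \<longlonglongrightarrow> d" "\<epsilon> \<longlonglongrightarrow> 0"
  shows "(\<lambda>k. bump (c' k) (d' k) (\<epsilon> k) t) \<longlonglongrightarrow> indicator {c<..<d} t"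
proof (cases "t \<in> {c<..<d}")
  case True
  then have pos: "(t - c) * (d - t) > 0"
    by auto
  then have "(\<lambda>k. bump (c' k) (d' k) (\<epsilon> k) t) \<longlonglongrightarrow>
      (max 0 ((t - c) * (d - t)))\<^sup>2 / ((max 0 ((t - c) * (d - t)))\<^sup>2 + 0)"
    unfolding bump_def by (intro tendsto_intros lim) (auto simp: max_def)
  with True pos show ?thesis
    by (auto simp: max_def)
next
  case False
  have "(t - c' k) * (d' k - t) \<le> 0" for k
    using assms(1-3)[of k] False by (auto simp: mult_le_0_iff not_less)
  with False show ?thesis
    by (simp add: bump_def)
qed

section \<open>The fundamental lemma of the calculus of variations: from test functions to
  intervals, Borel sets and Lebesgue sets\<close>

lemma finite_measure_lebesgue_on_Icc: "finite_measure (lebesgue_on {a..b::real})"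
  by (rule finite_measure_lebesgue_on) (use emeasure_lborel_cbox_finite[of a b] in \<open>simp add: less_top\<close>)

lemma integrable_indicator_scaleR_lebesgue_on:
  fixes g :: "real \<Rightarrow> 'e::{banach, second_countable_topology}"
  assumes g: "integrable (lebesgue_on {a..b}) g" and S: "S \<in> sets borel"
  shows "integrable (lebesgue_on {a..b}) (\<lambda>t. indicator S t *\<^sub>R g t)"
proof (rule Bochner_Integration.integrable_bound[OF g])
  have "(\<lambda>t. indicator S t :: real) \<in> borel_measurable (lebesgue_on {a..b})"
    using S by (intro measurable_restrict_space1 borel_measurable_indicator) auto
  then show "(\<lambda>t. indicator S t *\<^sub>R g t) \<in> borel_measurable (lebesgue_on {a..b})"
    using g by auto
qed (auto simp: indicator_def)

text \<open>A bump on (c, d) is supported in the closed interval, which may touch a or b. Bumps on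
  slightly smaller intervals are admissible test functions; they are bounded by 1 and tend to the
  indicator, so dominated convergence applies with majorant |g|.\<close>

lemma integral_Ioo_eq_0_if_orthogonal_test_functions:
  fixes g :: "real \<Rightarrow> 'e::{banach, second_countable_topology}"
  assumes g: "integrable (lebesgue_on {a..b}) g"
    and orth: "\<And>\<phi> \<phi>'. (\<And>t. (\<phi> has_real_derivative \<phi>' t) (at t)) \<Longrightarrow> continuous_on UNIV \<phi>' \<Longrightarrow>
        closure {t. \<phi> t \<noteq> 0} \<subseteq> {a<..<b} \<Longrightarrow> (LINT t|lebesgue_on {a..b}. \<phi> t *\<^sub>R g t) = 0"
    and cd: "a \<le> c" "c < d" "d \<le> b"
  shows "(LINT t|lebesgue_on {a..b}. indicator {c<..<d} t *\<^sub>R g t) = 0"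
proof -
  let ?M = "lebesgue_on {a..b}"
  \<comment> \<open>The shift by 3 keeps \<epsilon> below 1/2 from \<open>k = 0\<close> on, so that
    \<open>c' k < d' k\<close> always holds.\<close>
  define \<epsilon> where "\<epsilon> k = 1 / real (k + 3)" for k
  define c' where "c' k = c + (d - c) * \<epsilon> k" for k
  define d' where "d' k = d - (d - c) * \<epsilon> k" for k
  have \<epsilon>: "\<epsilon> \<longlonglongrightarrow> 0"
    unfolding \<epsilon>_def using LIMSEQ_ignore_initial_segment[OF lim_1_over_n, of 3] by simp
  have pos: "\<epsilon> k > 0" "\<epsilon> k < 1/2" for k
    by (auto simp: \<epsilon>_def field_simps)
  have c'd': "c < c' k" "c' k < d' k" "d' k < d" for k
  proof -
    have "(d - c) * \<epsilon> k > 0" "(d - c) * \<epsilon> k < (d - c) * (1/2)"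
      using pos[of k] cd by (auto intro!: mult_pos_pos mult_strict_left_mono)
    then show "c < c' k" "c' k < d' k" "d' k < d"
      by (auto simp: c'_def d'_def field_simps)
  qed
  have lim: "c' \<longlonglongrightarrow> c" "d' \<longlonglongrightarrow> d"
    unfolding c'_def d'_def by (auto intro!: tendsto_eq_intros \<epsilon>)
  let ?\<phi> = "\<lambda>k. bump (c' k) (d' k) (\<epsilon> k)"
  have m: "?\<phi> k \<in> borel_measurable ?M" for k
  proof -
    obtain \<phi>' where "\<And>t. (?\<phi> k has_real_derivative \<phi>' t) (at t)"
      using pos(1) by (rule bump_C1) auto
    then have "continuous_on UNIV (?\<phi> k)"
      using DERIV_isCont by (force simp: continuous_on_eq_continuous_at)
    then show ?thesis
      by (intro continuous_imp_measurable_on_sets_lebesgue) (auto intro: continuous_on_subset)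
  qed
  have "(\<lambda>k. LINT t|?M. ?\<phi> k t *\<^sub>R g t) \<longlonglongrightarrow> (LINT t|?M. indicator {c<..<d} t *\<^sub>R g t)"
  proof (rule integral_dominated_convergence)
    show "(\<lambda>t. indicator {c<..<d} t *\<^sub>R g t) \<in> borel_measurable ?M"
      using integrable_indicator_scaleR_lebesgue_on[OF g, of "{c<..<d}"] by auto
    show "(\<lambda>t. ?\<phi> k t *\<^sub>R g t) \<in> borel_measurable ?M" for k
      using m g by auto
    show "integrable ?M (\<lambda>t. norm (g t))"
      using g by auto
    show "AE t in ?M. (\<lambda>k. ?\<phi> k t *\<^sub>R g t) \<longlonglongrightarrow> indicator {c<..<d} t *\<^sub>R g t"
      by (intro AE_I2 tendsto_intros bump_tendsto_indicator c'd' lim \<epsilon>)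
    show "AE t in ?M. norm (?\<phi> k t *\<^sub>R g t) \<le> norm (g t)" for k
      using bump_bounds[OF pos(1)] by (intro AE_I2) (simp add: mult_left_le_one_le)
  qed
  moreover have "(LINT t|?M. ?\<phi> k t *\<^sub>R g t) = 0" for k
  proof -
    obtain \<phi>' where "\<And>t. (?\<phi> k has_real_derivative \<phi>' t) (at t)" "continuous_on UNIV \<phi>'"
      using pos(1) by (rule bump_C1) auto
    moreover have "closure {t. ?\<phi> k t \<noteq> 0} \<subseteq> {a<..<b}"
      using bump_support[of "c' k" "d' k" "\<epsilon> k"] c'd'[of k] cd by auto
    ultimately show ?thesis
      by (rule orth)
  qed
  ultimately show ?thesis
    by (simp add: LIMSEQ_const_iff)
qed

text \<open>A Dynkin class argument: open intervals form an intersection-stable generator of the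
  Borel sets, and a vanishing integral passes to complements and to countable disjoint
  unions.\<close>

lemma integral_borel_set_eq_0_if_orthogonal_test_functions:
  fixes g :: "real \<Rightarrow> 'e::{banach, second_countable_topology}"
  assumes g: "integrable (lebesgue_on {a..b}) g"
    and orth: "\<And>\<phi> \<phi>'. (\<And>t. (\<phi> has_real_derivative \<phi>' t) (at t)) \<Longrightarrow> continuous_on UNIV \<phi>' \<Longrightarrow>
        closure {t. \<phi> t \<noteq> 0} \<subseteq> {a<..<b} \<Longrightarrow> (LINT t|lebesgue_on {a..b}. \<phi> t *\<^sub>R g t) = 0"
    and S: "S \<in> sets borel"
  shows "(LINT t|lebesgue_on {a..b}. indicator S t *\<^sub>R g t) = 0"
proof -
  let ?M = "lebesgue_on {a..b}"
  note intA = integrable_indicator_scaleR_lebesgue_on[OF g]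
  have ivl: "(LINT t|?M. indicator {c<..<d} t *\<^sub>R g t) = 0" if "a \<le> c" "c < d" "d \<le> b" for c d
    by (rule integral_Ioo_eq_0_if_orthogonal_test_functions[OF g _ that]) (rule orth)
  have ivl': "(LINT t|?M. indicator {c<..<d} t *\<^sub>R g t) = 0" for c d
  proof -
    \<comment> \<open>Within [a, b], cutting the interval down to (a, b) can lose at most the points
      a and b.\<close>
    have "AE t in ?M. indicator {c<..<d} t *\<^sub>R g t = indicator {max a c<..<min b d} t *\<^sub>R g t"
    proof (rule AE_I')
      show "{a, b} \<inter> {a..b} \<in> null_sets ?M"
        by (auto simp: null_sets_restrict_space intro!: null_sets_completionI finite_imp_null_set_lborel)
    qed (auto simp: indicator_def)
    then have "(LINT t|?M. indicator {c<..<d} t *\<^sub>R g t)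
        = (LINT t|?M. indicator {max a c<..<min b d} t *\<^sub>R g t)"
      using intA[of "{c<..<d}"] intA[of "{max a c<..<min b d}"]
      by (intro integral_cong_AE) (auto intro: borel_measurable_integrable)
    then show ?thesis
      using ivl[of "max a c" "min b d"] by (cases "max a c < min b d") auto
  qed
  let ?G = "range (\<lambda>(c, d). box c (d::real))"
  have gen: "sets borel = sigma_sets UNIV ?G"
    by (simp add: borel_eq_box)
  have stable: "Int_stable ?G"
    by (auto simp: Int_stable_def box_Int_box)
  have S': "S \<in> sigma_sets UNIV ?G"
    using S gen by simp
  show ?thesis
  proof (rule sigma_sets_induct_disjoint[OF stable _ S'])
    show "?G \<subseteq> Pow UNIV" by simp
  next
    fix A assume "A \<in> ?G"
    then show "(LINT t|?M. indicator A t *\<^sub>R g t) = 0"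
      using ivl' by auto
  next
    show "(LINT t|?M. indicator {} t *\<^sub>R g t) = 0" by simp
  next
    fix A assume A: "A \<in> sigma_sets UNIV ?G" "(LINT t|?M. indicator A t *\<^sub>R g t) = 0"
    \<comment> \<open>On [a, b] the interval (a - 1, b + 1) serves as the whole line, and as an
      interval it already has integral 0.\<close>
    have "(LINT t|?M. indicator (UNIV - A) t *\<^sub>R g t)
        = (LINT t|?M. indicator {a-1<..<b+1} t *\<^sub>R g t - indicator A t *\<^sub>R g t)"
      by (intro Bochner_Integration.integral_cong) (auto simp: indicator_def)
    also have "\<dots> = 0"
      using A gen by (subst Bochner_Integration.integral_diff) (auto simp: ivl' intro!: intA)
    finally show "(LINT t|?M. indicator (UNIV - A) t *\<^sub>R g t) = 0" .
  next
    fix A :: "nat \<Rightarrow> real set"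
    assume A: "disjoint_family A" "range A \<subseteq> sigma_sets UNIV ?G"
      "\<And>i. (LINT t|?M. indicator (A i) t *\<^sub>R g t) = 0"
    have m: "A i \<in> sets borel" for i
      using A gen by auto
    have "(\<lambda>n. LINT t|?M. indicator (\<Union>i<n. A i) t *\<^sub>R g t)
        \<longlonglongrightarrow> (LINT t|?M. indicator (\<Union>i. A i) t *\<^sub>R g t)"
    proof (rule integral_dominated_convergence)
      show "integrable ?M (\<lambda>t. norm (g t))"
        using g by auto
      show "(\<lambda>t. indicator (\<Union>i. A i) t *\<^sub>R g t) \<in> borel_measurable ?M"
        "(\<lambda>t. indicator (\<Union>i<n. A i) t *\<^sub>R g t) \<in> borel_measurable ?M" for n
        using m by (auto intro!: borel_measurable_integrable intA)
      show "AE t in ?M. (\<lambda>n. indicator (\<Union>i<n. A i) t *\<^sub>R g t) \<longlonglongrightarrow> indicator (\<Union>i. A i) t *\<^sub>R g t"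
        by (intro AE_I2 tendsto_intros LIMSEQ_indicator_UN)
      show "AE t in ?M. norm (indicator (\<Union>i<n. A i) t *\<^sub>R g t) \<le> norm (g t)" for n
        by (intro AE_I2) (auto simp: indicator_def)
    qed
    moreover have "(LINT t|?M. indicator (\<Union>i<n. A i) t *\<^sub>R g t) = 0" for n
    proof -
      have "indicator (\<Union>i<n. A i) t *\<^sub>R g t = (\<Sum>i<n. indicator (A i) t *\<^sub>R g t)" for t
        using A(1) by (subst indicator_UN_disjoint)
          (auto simp: scaleR_left.sum disjoint_family_on_def)
      then show ?thesis
        by (simp only: Bochner_Integration.integral_sum[OF intA[OF m]] A(3) sum.neutral_const)
    qed
    ultimately show "(LINT t|?M. indicator (\<Union>i. A i) t *\<^sub>R g t) = 0"
      by (simp add: LIMSEQ_const_iff)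
  qed
qed

text \<open>The measurable sets of \<open>lebesgue_on\<close> are Lebesgue sets; each is a Borel set
  up to a null set, so the Borel case determines the integral of g over all of them, and g vanishes
  almost everywhere.\<close>

lemma AE_eq_0_if_orthogonal_test_functions:
  fixes g :: "real \<Rightarrow> 'e::{banach, second_countable_topology}"
  assumes g: "integrable (lebesgue_on {a..b}) g"
    and orth: "\<And>\<phi> \<phi>'. (\<And>t. (\<phi> has_real_derivative \<phi>' t) (at t)) \<Longrightarrow> continuous_on UNIV \<phi>' \<Longrightarrow>
        closure {t. \<phi> t \<noteq> 0} \<subseteq> {a<..<b} \<Longrightarrow> (LINT t|lebesgue_on {a..b}. \<phi> t *\<^sub>R g t) = 0"
  shows "AE t in lebesgue_on {a..b}. g t = 0"
proof -
  let ?M = "lebesgue_on {a..b}"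
  note intA = integrable_indicator_scaleR_lebesgue_on[OF g]
  have borel: "(LINT t|?M. indicator S t *\<^sub>R g t) = 0" if "S \<in> sets borel" for S
    by (rule integral_borel_set_eq_0_if_orthogonal_test_functions[OF g _ that]) (rule orth)
  show ?thesis
  proof (rule sigma_finite_measure.density_zero[OF _ g])
    show "sigma_finite_measure ?M"
      using finite_measure_lebesgue_on_Icc finite_measure.axioms(1) by blast
    fix A assume "A \<in> sets ?M"
    then have A: "A \<in> sets lebesgue"
      by (auto simp: sets_restrict_space_iff)
    then obtain S N N' where SN: "A = S \<union> N" "N \<subseteq> N'" "N' \<in> null_sets lborel" "S \<in> sets lborel"
      by (rule sets_completionE)
    have "AE t in ?M. indicator A t *\<^sub>R g t = indicator S t *\<^sub>R g t"
    proof (rule AE_I')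
      show "N' \<inter> {a..b} \<in> null_sets ?M"
        using SN by (subst null_sets_restrict_space) (auto intro: null_sets_completionI null_set_Int2)
    qed (use SN in \<open>auto simp: indicator_def\<close>)
    then have "(LINT t|?M. indicator A t *\<^sub>R g t) = (LINT t|?M. indicator S t *\<^sub>R g t)"
      using \<open>A \<in> sets ?M\<close> SN g
      by (intro integral_cong_AE) (auto intro!: borel_measurable_integrable[OF intA])
    then show "set_lebesgue_integral ?M A g = 0"
      using borel SN by (simp add: set_lebesgue_integral_def)
  qed
qed


section \<open>The space $W^{1,q}$\<close>

lemma Lq_imp_integrable:
  assumes "f \<in> Lq q a b" "1 \<le> q"
  shows "integrable (lebesgue_on {a..b}) f"
proof (rule Bochner_Integration.integrable_bound)
  show "integrable (lebesgue_on {a..b}) (\<lambda>t. 1 + norm (f t) powr q)"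
    using assms finite_measure_lebesgue_on_Icc[of a b]
    by (auto simp: Lq_def intro!: finite_measure.integrable_const)
  have "x \<le> 1 + x powr q" if "x \<ge> 0" for x :: real
    using powr_mono[of 1 q x] that assms(2) by (cases "x \<le> 1") (auto simp: add_increasing2)
  then show "AE t in lebesgue_on {a..b}. norm (f t) \<le> norm (1 + norm (f t) powr q)"
    by (intro AE_I2) simp
qed (use assms in \<open>auto simp: Lq_def\<close>)

lemma Lq_add:
  assumes "f \<in> Lq q a b" "g \<in> Lq q a b" "1 \<le> q"
  shows "(\<lambda>t. f t + g t) \<in> Lq q a b"
proof -
  have "integrable (lebesgue_on {a..b}) (\<lambda>t. norm (f t + g t) powr q)"
  proof (rule Bochner_Integration.integrable_bound)
    show "integrable (lebesgue_on {a..b}) (\<lambda>t. 3 powr q * (norm (f t) powr q + norm (g t) powr q))"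
      using assms by (auto simp: Lq_def)
    have "norm (f t + g t) powr q \<le> 3 powr q * (norm (f t) powr q + norm (g t) powr q)" for t
    proof -
      have "norm (f t + g t) powr q \<le> (norm (f t) + norm (g t) + 0) powr q"
        using assms norm_triangle_ineq by (intro powr_mono2) auto
      then show ?thesis
        using powr_add3_le[of "norm (f t)" "norm (g t)" 0 q] assms by simp
    qed
    then show "AE t in lebesgue_on {a..b}. norm (norm (f t + g t) powr q)
        \<le> norm (3 powr q * (norm (f t) powr q + norm (g t) powr q))"
      by (intro AE_I2) simp
  qed (use assms in \<open>auto simp: Lq_def\<close>)
  then show ?thesis
    using assms by (auto simp: Lq_def)
qed

lemma Lq_scaleR:
  assumes "f \<in> Lq q a b"
  shows "(\<lambda>t. c *\<^sub>R f t) \<in> Lq q a b"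
  using assms by (auto simp: Lq_def powr_mult)

lemma Lq_cong_AE:
  assumes "f \<in> Lq q a b" "g \<in> borel_measurable (lebesgue_on {a..b})"
    and "AE t in lebesgue_on {a..b}. g t = f t"
  shows "g \<in> Lq q a b"
proof -
  have "integrable (lebesgue_on {a..b}) (\<lambda>t. norm (g t) powr q)
      \<longleftrightarrow> integrable (lebesgue_on {a..b}) (\<lambda>t. norm (f t) powr q)"
    using assms by (intro integrable_cong_AE) (auto simp: Lq_def)
  then show ?thesis
    using assms by (auto simp: Lq_def)
qed

lemma integrable_continuous_scaleR:
  fixes g :: "real \<Rightarrow> 'e::{banach, second_countable_topology}" and \<phi> :: "real \<Rightarrow> real"
  assumes "continuous_on {a..b} \<phi>" and g: "integrable (lebesgue_on {a..b}) g"
  shows "integrable (lebesgue_on {a..b}) (\<lambda>t. \<phi> t *\<^sub>R g t)"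
proof -
  have "bounded (\<phi> ` {a..b})"
    using assms by (intro compact_imp_bounded compact_continuous_image) auto
  then obtain B where "\<forall>x\<in>\<phi> ` {a..b}. norm x \<le> B"
    unfolding bounded_iff by blast
  then have B: "norm (\<phi> t) \<le> B" if "t \<in> {a..b}" for t
    using that by blast
  have [measurable]: "\<phi> \<in> borel_measurable (lebesgue_on {a..b})"
    using assms(1) by (rule continuous_imp_measurable_on_sets_lebesgue) auto
  have [measurable]: "g \<in> borel_measurable (lebesgue_on {a..b})"
    using g by auto
  show ?thesis
  proof (rule Bochner_Integration.integrable_bound)
    show "integrable (lebesgue_on {a..b}) (\<lambda>t. B * norm (g t))"
      using g by auto
    show "AE t in lebesgue_on {a..b}. norm (\<phi> t *\<^sub>R g t) \<le> norm (B * norm (g t))"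
    proof (rule AE_I2)
      fix t assume "t \<in> space (lebesgue_on {a..b})"
      then have "norm (\<phi> t) * norm (g t) \<le> B * norm (g t)"
        using B by (intro mult_right_mono) auto
      then show "norm (\<phi> t *\<^sub>R g t) \<le> norm (B * norm (g t))"
        by simp
    qed
  qed measurable
qed

lemma has_weak_deriv_unique:
  fixes y g h :: "real \<Rightarrow> real ^ 'n"
  assumes g: "integrable (lebesgue_on {a..b}) g" "has_weak_deriv a b y g"
    and h: "integrable (lebesgue_on {a..b}) h" "has_weak_deriv a b y h"
  shows "AE t in lebesgue_on {a..b}. g t = h t"
proof -
  have "AE t in lebesgue_on {a..b}. g t - h t = 0"
  proof (rule AE_eq_0_if_orthogonal_test_functions)
    fix \<phi> \<phi>' :: "real \<Rightarrow> real"
    assume \<phi>: "\<And>t. (\<phi> has_real_derivative \<phi>' t) (at t)" "continuous_on UNIV \<phi>'"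
      "closure {t. \<phi> t \<noteq> 0} \<subseteq> {a<..<b}"
    have cont: "continuous_on {a..b} \<phi>"
      using \<phi>(1) by (meson DERIV_isCont continuous_at_imp_continuous_on)
    have "(LINT t|lebesgue_on {a..b}. \<phi> t *\<^sub>R g t) = (LINT t|lebesgue_on {a..b}. \<phi> t *\<^sub>R h t)"
    proof -
      have "(LINT t|lebesgue_on {a..b}. \<phi>' t *\<^sub>R y t) = - (LINT t|lebesgue_on {a..b}. \<phi> t *\<^sub>R g t)"
        "(LINT t|lebesgue_on {a..b}. \<phi>' t *\<^sub>R y t) = - (LINT t|lebesgue_on {a..b}. \<phi> t *\<^sub>R h t)"
        using g(2) h(2) \<phi> unfolding has_weak_deriv_def by blast+
      then show ?thesis
        by simp
    qed
    then show "(LINT t|lebesgue_on {a..b}. \<phi> t *\<^sub>R (g t - h t)) = 0"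
      using integrable_continuous_scaleR[OF cont g(1)] integrable_continuous_scaleR[OF cont h(1)]
      by (simp add: scaleR_diff_right)
  qed (use g h in auto)
  then show ?thesis
    by eventually_elim simp
qed

lemma has_weak_deriv_add:
  fixes y z g h :: "real \<Rightarrow> real ^ 'n"
  assumes y: "integrable (lebesgue_on {a..b}) y" and g: "integrable (lebesgue_on {a..b}) g"
    and z: "integrable (lebesgue_on {a..b}) z" and h: "integrable (lebesgue_on {a..b}) h"
    and wd: "has_weak_deriv a b y g" "has_weak_deriv a b z h"
  shows "has_weak_deriv a b (\<lambda>t. y t + z t) (\<lambda>t. g t + h t)"
  unfolding has_weak_deriv_def
proof (intro allI impI, elim conjE)
  fix \<phi> \<phi>' :: "real \<Rightarrow> real"
  assume \<phi>: "\<forall>t. (\<phi> has_real_derivative \<phi>' t) (at t)" "continuous_on UNIV \<phi>'"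
    "closure {t. \<phi> t \<noteq> 0} \<subseteq> {a<..<b}"
  have cont: "continuous_on {a..b} \<phi>" "continuous_on {a..b} \<phi>'"
    using \<phi>(1,2) by (auto intro: continuous_at_imp_continuous_on DERIV_isCont continuous_on_subset)
  note int = integrable_continuous_scaleR[OF cont(1)] integrable_continuous_scaleR[OF cont(2)]
  have "(LINT t|lebesgue_on {a..b}. \<phi>' t *\<^sub>R y t) = - (LINT t|lebesgue_on {a..b}. \<phi> t *\<^sub>R g t)"
    "(LINT t|lebesgue_on {a..b}. \<phi>' t *\<^sub>R z t) = - (LINT t|lebesgue_on {a..b}. \<phi> t *\<^sub>R h t)"
    using wd \<phi> unfolding has_weak_deriv_def by blast+
  then show "(LINT t|lebesgue_on {a..b}. \<phi>' t *\<^sub>R (y t + z t))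
      = - (LINT t|lebesgue_on {a..b}. \<phi> t *\<^sub>R (g t + h t))"
    using int(1)[OF g] int(1)[OF h] int(2)[OF y] int(2)[OF z] by (simp add: scaleR_add_right)
qed

lemma has_weak_deriv_scaleR:
  fixes y g :: "real \<Rightarrow> real ^ 'n"
  assumes "has_weak_deriv a b y g"
  shows "has_weak_deriv a b (\<lambda>t. c *\<^sub>R y t) (\<lambda>t. c *\<^sub>R g t)"
  unfolding has_weak_deriv_def
proof (intro allI impI)
  fix \<phi> \<phi>' :: "real \<Rightarrow> real"
  assume \<phi>: "(\<forall>t. (\<phi> has_real_derivative \<phi>' t) (at t)) \<and> continuous_on UNIV \<phi>' \<and>
    closure {t. \<phi> t \<noteq> 0} \<subseteq> {a<..<b}"
  have scale: "(LINT t|lebesgue_on {a..b}. \<psi> t *\<^sub>R c *\<^sub>R x t) = c *\<^sub>R (LINT t|lebesgue_on {a..b}. \<psi> t *\<^sub>R x t)"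
    for \<psi> :: "real \<Rightarrow> real" and x :: "real \<Rightarrow> real ^ 'n"
    by (simp only: scaleR_left_commute[of _ c] Bochner_Integration.integral_scaleR_right)
  show "(LINT t|lebesgue_on {a..b}. \<phi>' t *\<^sub>R c *\<^sub>R y t) = - (LINT t|lebesgue_on {a..b}. \<phi> t *\<^sub>R c *\<^sub>R g t)"
    by (simp only: scale assms[unfolded has_weak_deriv_def, rule_format, OF \<phi>] scaleR_minus_right)
qed

text \<open>One integrable weak derivative shows that the choice behind \<open>wderiv\<close> is not
  vacuous; uniqueness then identifies the chosen function with the given one almost
  everywhere.\<close>

lemma wderiv_AE_eq:
  assumes "integrable (lebesgue_on {a..b}) g" "has_weak_deriv a b y g"
  shows "AE t in lebesgue_on {a..b}. wderiv a b y t = g t"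
    and "integrable (lebesgue_on {a..b}) (wderiv a b y)" and "has_weak_deriv a b y (wderiv a b y)"
proof -
  have "integrable (lebesgue_on {a..b}) (wderiv a b y) \<and> has_weak_deriv a b y (wderiv a b y)"
    using assms unfolding wderiv_def
    by (rule someI[of "\<lambda>g. integrable (lebesgue_on {a..b}) g \<and> has_weak_deriv a b y g", OF conjI])
  with assms has_weak_deriv_unique
  show "AE t in lebesgue_on {a..b}. wderiv a b y t = g t"
    "integrable (lebesgue_on {a..b}) (wderiv a b y)" "has_weak_deriv a b y (wderiv a b y)"
    by blast+
qed

text \<open>The choice in \<open>wderiv\<close> asks for integrability only. Membership in L^q is
  inherited, almost everywhere, from the weak derivative that \<open>W1q\<close> provides.\<close>

lemma wderiv_in_Lq:
  assumes "y \<in> W1q q a b" "1 \<le> q"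
  shows "wderiv a b y \<in> Lq q a b" "has_weak_deriv a b y (wderiv a b y)"
proof -
  obtain g where g: "g \<in> Lq q a b" "has_weak_deriv a b y g"
    using assms by (auto simp: W1q_def)
  note * = wderiv_AE_eq[OF Lq_imp_integrable[OF g(1) assms(2)] g(2)]
  show "wderiv a b y \<in> Lq q a b"
    using *(2) by (intro Lq_cong_AE[OF g(1) _ *(1)]) auto
  show "has_weak_deriv a b y (wderiv a b y)"
    by (rule *(3))
qed

text \<open>The weak derivative of the sum is chosen independently of those of the summands, so
  additivity can hold only almost everywhere.\<close>

lemma W1q_add:
  assumes y: "y \<in> W1q q a b" and z: "z \<in> W1q q a b" and q: "1 \<le> q"
  shows "(\<lambda>t. y t + z t) \<in> W1q q a b"
    and "AE t in lebesgue_on {a..b}. wderiv a b (\<lambda>t. y t + z t) t = wderiv a b y t + wderiv a b z t"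
proof -
  have Lq: "(\<lambda>t. wderiv a b y t + wderiv a b z t) \<in> Lq q a b"
    by (intro Lq_add wderiv_in_Lq(1)[OF y q] wderiv_in_Lq(1)[OF z q] q)
  have wd: "has_weak_deriv a b (\<lambda>t. y t + z t) (\<lambda>t. wderiv a b y t + wderiv a b z t)"
    using y z q
    by (intro has_weak_deriv_add Lq_imp_integrable[OF _ q] wderiv_in_Lq[OF y] wderiv_in_Lq[OF z])
       (auto simp: W1q_def)
  show "(\<lambda>t. y t + z t) \<in> W1q q a b"
    using y z q Lq wd by (auto simp: W1q_def intro!: continuous_on_add Lq_add)
  show "AE t in lebesgue_on {a..b}. wderiv a b (\<lambda>t. y t + z t) t = wderiv a b y t + wderiv a b z t"
    by (rule wderiv_AE_eq(1)[OF Lq_imp_integrable[OF Lq q] wd])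
qed

lemma W1q_scaleR:
  assumes y: "y \<in> W1q q a b" and q: "1 \<le> q"
  shows "(\<lambda>t. c *\<^sub>R y t) \<in> W1q q a b"
    and "AE t in lebesgue_on {a..b}. wderiv a b (\<lambda>t. c *\<^sub>R y t) t = c *\<^sub>R wderiv a b y t"
proof -
  have Lq: "(\<lambda>t. c *\<^sub>R wderiv a b y t) \<in> Lq q a b"
    by (intro Lq_scaleR wderiv_in_Lq(1)[OF y q])
  have wd: "has_weak_deriv a b (\<lambda>t. c *\<^sub>R y t) (\<lambda>t. c *\<^sub>R wderiv a b y t)"
    by (intro has_weak_deriv_scaleR wderiv_in_Lq(2)[OF y q])
  show "(\<lambda>t. c *\<^sub>R y t) \<in> W1q q a b"
    using y Lq wd by (auto simp: W1q_def intro!: continuous_intros Lq_scaleR)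
  show "AE t in lebesgue_on {a..b}. wderiv a b (\<lambda>t. c *\<^sub>R y t) t = c *\<^sub>R wderiv a b y t"
    by (rule wderiv_AE_eq(1)[OF Lq_imp_integrable[OF Lq q] wd])
qed

section \<open>Scaling of the W^{1,q} norm and admissible variations\<close>

lemma W1q_norm_nonneg: "0 \<le> W1q_norm q a b y"
  by (simp add: W1q_norm_def)

lemma W1q_norm_scaleR:
  assumes y: "y \<in> W1q q a b" and q: "1 \<le> q"
  shows "W1q_norm q a b (\<lambda>t. c *\<^sub>R y t) = \<bar>c\<bar> * W1q_norm q a b y"
proof -
  let ?M = "lebesgue_on {a..b}"
  have m [measurable]: "wderiv a b y \<in> borel_measurable ?M"
    "wderiv a b (\<lambda>t. c *\<^sub>R y t) \<in> borel_measurable ?M"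
    using wderiv_in_Lq(1)[OF y q] wderiv_in_Lq(1)[OF W1q_scaleR(1)[OF y q] q] by (simp_all add: Lq_def)
  have root: "(\<bar>c\<bar> powr q * x) powr (1 / q) = \<bar>c\<bar> * x powr (1 / q)" if "x \<ge> 0" for x
    using that q by (simp add: powr_mult powr_powr)
  have "(LINT t|?M. norm (wderiv a b (\<lambda>t. c *\<^sub>R y t) t) powr q)
      = (LINT t|?M. \<bar>c\<bar> powr q * norm (wderiv a b y t) powr q)"
  proof (rule integral_cong_AE)
    show "AE t in ?M. norm (wderiv a b (\<lambda>t. c *\<^sub>R y t) t) powr q
        = \<bar>c\<bar> powr q * norm (wderiv a b y t) powr q"
      using W1q_scaleR(2)[OF y q, of c] by eventually_elim (simp add: powr_mult)
  qed (use m in measurable)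
  then have deriv: "(LINT t|?M. norm (wderiv a b (\<lambda>t. c *\<^sub>R y t) t) powr q)
      = \<bar>c\<bar> powr q * (LINT t|?M. norm (wderiv a b y t) powr q)"
    by simp
  have fun_eq: "(LINT t|?M. norm (c *\<^sub>R y t) powr q) = \<bar>c\<bar> powr q * (LINT t|?M. norm (y t) powr q)"
    by (simp add: powr_mult)
  show ?thesis
    unfolding W1q_norm_def deriv fun_eq by (simp add: root distrib_left)
qed

lemma W1q_0_0: "(\<lambda>_. 0) \<in> W1q_0 q a b"
  by (auto simp: W1q_0_def W1q_def Lq_def has_weak_deriv_def intro!: exI[of _ "\<lambda>_. 0"])

lemma W1q_0_scaleR:
  assumes "v \<in> W1q_0 q a b" "1 \<le> q"
  shows "(\<lambda>t. c *\<^sub>R v t) \<in> W1q_0 q a b"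
  using assms W1q_scaleR(1) by (auto simp: W1q_0_def)

lemma X1_add_W1q_0:
  assumes "y \<in> X1 q a b A B" "v \<in> W1q_0 q a b" "1 \<le> q"
  shows "(\<lambda>t. y t + v t) \<in> X1 q a b A B"
  using assms W1q_add(1) by (auto simp: W1q_0_def X1_def)


section \<open>Differentiability of integral functionals at a minimizer\<close>

text \<open>Continuity of F is given only over [a, b]. Clamping the time to [a, b] makes the
  composite continuous everywhere, hence Borel, and changes nothing on the space of the
  measure.\<close>

lemma borel_measurable_superposition:
  fixes F :: "real \<Rightarrow> 'z::{second_countable_topology, real_normed_vector} \<Rightarrow> 'e::topological_space"
  assumes F: "continuous_on ({a..b} \<times> UNIV) (\<lambda>(t, z). F t z)"
    and z: "z \<in> borel_measurable (lebesgue_on {a..b})"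
  shows "(\<lambda>t. F t (z t)) \<in> borel_measurable (lebesgue_on {a..b})"
proof (cases "a \<le> b")
  case True
  define r where "r t = max a (min b t)" for t
  have r: "continuous_on UNIV (\<lambda>(t, z::'z). (r t, z))"
    unfolding r_def case_prod_beta by (intro continuous_intros)
  have "continuous_on UNIV ((\<lambda>(t, z). F t z) \<circ> (\<lambda>(t, z). (r t, z)))"
    using True by (intro continuous_on_compose r continuous_on_subset[OF F]) (auto simp: r_def)
  then have "(\<lambda>(t, z). F t z) \<circ> (\<lambda>(t, z). (r t, z)) \<in> borel_measurable borel"
    by (rule borel_measurable_continuous_onI)
  moreover have "(\<lambda>t. (t, z t)) \<in> borel_measurable (lebesgue_on {a..b})"
    by (intro borel_measurable_Pair[OF _ z] measurable_restrict_space1 measurable_completion) auto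
  ultimately have "(\<lambda>t. ((\<lambda>(t, z). F t z) \<circ> (\<lambda>(t, z). (r t, z))) (t, z t))
      \<in> borel_measurable (lebesgue_on {a..b})"
    by (rule measurable_compose[rotated])
  then show ?thesis
    by (rule subst[OF measurable_cong, rotated]) (auto simp: r_def)
next
  case False
  then show ?thesis
    by (auto simp: measurable_def space_restrict_space)
qed

text \<open>The pair (y, p) is one variable z, and \<open>D t z\<close> is the Frechet derivative in
  z. Joint continuity of D in all three arguments serves the measurability of the linear term of the
  expansion.\<close>

locale growth_integrand =
  fixes a b q \<kappa> :: real and f :: "real \<Rightarrow> 'z::euclidean_space \<Rightarrow> real"
    and D :: "real \<Rightarrow> 'z \<Rightarrow> 'z \<Rightarrow> real"
  assumes q: "1 < q" and \<kappa>: "0 \<le> \<kappa>"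
    and cont_f: "continuous_on ({a..b} \<times> UNIV) (\<lambda>(t, z). f t z)"
    and cont_D: "continuous_on ({a..b} \<times> UNIV) (\<lambda>(t, z, w). D t z w)"
    and deriv: "\<And>t z. t \<in> {a..b} \<Longrightarrow> (f t has_derivative D t z) (at z)"
    and growth: "\<And>t z w. t \<in> {a..b} \<Longrightarrow> \<bar>D t z w\<bar> \<le> \<kappa> * (norm z powr (q - 1) + 1) * norm w"
begin

text \<open>The mean value inequality on the ball of radius |z| + |w|, which contains z and z + w
  and on which the operator norm of D is uniformly bounded.\<close>

lemma increment_le:
  assumes t: "t \<in> {a..b}"
  shows "\<bar>f t (z + w) - f t z\<bar> \<le> \<kappa> * ((norm z + norm w) powr (q - 1) + 1) * norm w"
proof -
  let ?S = "cball (0::'z) (norm z + norm w)"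
  have "norm (f t (z + w) - f t z) \<le> \<kappa> * ((norm z + norm w) powr (q - 1) + 1) * norm (z + w - z)"
  proof (rule differentiable_bound[of ?S "f t" "D t"])
    fix x assume x: "x \<in> ?S"
    show "(f t has_derivative D t x) (at x within ?S)"
      using deriv[OF t] has_derivative_at_withinI by blast
    have "norm x powr (q - 1) \<le> (norm z + norm w) powr (q - 1)"
      using x q by (intro powr_mono2) auto
    then have "\<kappa> * (norm x powr (q - 1) + 1) \<le> \<kappa> * ((norm z + norm w) powr (q - 1) + 1)"
      using \<kappa> by (intro mult_left_mono) auto
    then have "\<bar>D t x u\<bar> \<le> \<kappa> * ((norm z + norm w) powr (q - 1) + 1) * norm u" for u
      by (intro order.trans[OF growth[OF t] mult_right_mono]) auto
    then show "onorm (D t x) \<le> \<kappa> * ((norm z + norm w) powr (q - 1) + 1)"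
      using \<kappa> by (intro onorm_bound) auto
  qed (auto intro: norm_triangle_ineq)
  then show ?thesis
    by simp
qed

text \<open>The power 3^(q - 1) comes from splitting (|z| + |w|)^(q - 1), the summand 1 absorbs the
  constant. With s = 1 + |z|^(q - 1) + |w|^(q - 1), increment and linear term are then each at most
  K s |w|, which yields the 2 K in the remainder bound.\<close>

definition "K = \<kappa> * (3 powr (q - 1) + 1)"

lemma K_nonneg: "K \<ge> 0"
  using \<kappa> by (simp add: K_def)

lemma remainder_le:
  assumes t: "t \<in> {a..b}"
  shows "\<bar>f t (z + w) - f t z - D t z w\<bar>
      \<le> 2 * K * (1 + norm z powr (q - 1) + norm w powr (q - 1)) * norm w"
proof -
  let ?s = "1 + norm z powr (q - 1) + norm w powr (q - 1)"
  have "(norm z + norm w) powr (q - 1) \<le> 3 powr (q - 1) * (norm z powr (q - 1) + norm w powr (q - 1))"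
    using powr_add3_le[of "norm z" "norm w" 0 "q - 1"] q by simp
  also have "\<dots> \<le> 3 powr (q - 1) * ?s"
    by (intro mult_left_mono) auto
  finally have "(norm z + norm w) powr (q - 1) + 1 \<le> (3 powr (q - 1) + 1) * ?s"
    by (simp add: distrib_right add_increasing2)
  moreover have "1 * (norm z powr (q - 1) + 1) \<le> (3 powr (q - 1) + 1) * ?s"
    by (intro mult_mono) auto
  ultimately have "\<kappa> * ((norm z + norm w) powr (q - 1) + 1) * norm w \<le> K * ?s * norm w"
    "\<kappa> * (norm z powr (q - 1) + 1) * norm w \<le> K * ?s * norm w"
    unfolding K_def mult.assoc[of \<kappa> "3 powr (q - 1) + 1"] using \<kappa>
    by (intro mult_right_mono mult_left_mono; simp)+
  with increment_le[OF t, of z w] growth[OF t, of z w]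
  have "\<bar>f t (z + w) - f t z - D t z w\<bar> \<le> K * ?s * norm w + K * ?s * norm w"
    by linarith
  then show ?thesis
    by (simp add: algebra_simps)
qed

text \<open>Since (q - 1) times q/(q - 1) is q, the conjugate power turns growth of order q - 1 into
  order q. The 6 is the 2 of the remainder bound times the 3 from splitting three summands.\<close>

lemma remainder_quotient_le:
  assumes t: "t \<in> {a..b}"
  shows "(\<bar>f t (z + w) - f t z - D t z w\<bar> / norm w) powr (q / (q - 1))
      \<le> (6 * K) powr (q / (q - 1)) * (1 + norm z powr q) + (6 * K) powr (q / (q - 1)) * norm w powr q"
proof -
  let ?p = "q / (q - 1)" and ?s = "1 + norm z powr (q - 1) + norm w powr (q - 1)"
  have p: "(q - 1) * ?p = q" "?p \<ge> 0"
    using q by auto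
  have "\<bar>f t (z + w) - f t z - D t z w\<bar> / norm w \<le> 2 * K * ?s"
    using remainder_le[OF t, of z w] K_nonneg by (cases "w = 0") (auto simp: divide_simps)
  then have "(\<bar>f t (z + w) - f t z - D t z w\<bar> / norm w) powr ?p \<le> (2 * K * ?s) powr ?p"
    using p by (intro powr_mono2) auto
  also have "\<dots> = (2 * K) powr ?p * ?s powr ?p"
    using K_nonneg by (intro powr_mult)
  also have "\<dots> \<le> (2 * K) powr ?p * (3 powr ?p * (1 powr ?p + (norm z powr (q - 1)) powr ?p
      + (norm w powr (q - 1)) powr ?p))"
    using p by (intro mult_left_mono powr_add3_le) auto
  also have "\<dots> = ((2 * K) powr ?p * 3 powr ?p) * (1 + norm z powr q + norm w powr q)"
    by (simp add: powr_powr p del: times_divide_eq_right)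
  also have "(2 * K) powr ?p * 3 powr ?p = (6 * K) powr ?p"
    using K_nonneg by (subst powr_mult[symmetric]) auto
  finally show ?thesis
    by (simp add: distrib_left)
qed

context
  fixes z0 :: "real \<Rightarrow> 'z"
  assumes z0: "z0 \<in> borel_measurable (lebesgue_on {a..b})"
    and z0_int: "integrable (lebesgue_on {a..b}) (\<lambda>t. norm (z0 t) powr q)"
begin

lemma Lq_remainder_increment:
  "Lq_remainder (lebesgue_on {a..b}) q ((6 * K) powr (q / (q - 1)))
     (\<lambda>t. (6 * K) powr (q / (q - 1)) * (1 + norm (z0 t) powr q))
     (\<lambda>t w. f t (z0 t + w) - f t (z0 t) - D t (z0 t) w)"
proof
  show "integrable (lebesgue_on {a..b}) (\<lambda>t. (6 * K) powr (q / (q - 1)) * (1 + norm (z0 t) powr q))"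
    using z0_int finite_measure_lebesgue_on_Icc[of a b]
    by (auto intro!: finite_measure.integrable_const)
  fix z :: "real \<Rightarrow> 'z" assume z: "z \<in> borel_measurable (lebesgue_on {a..b})"
  \<comment> \<open>D is read as a function of the time and of one pair, so that a single
    superposition covers both base point and direction.\<close>
  have "(\<lambda>t. D t (fst (z0 t, z t)) (snd (z0 t, z t))) \<in> borel_measurable (lebesgue_on {a..b})"
    using cont_D z z0
    by (intro borel_measurable_superposition[where F = "\<lambda>t p. D t (fst p) (snd p)"] borel_measurable_Pair)
       (auto simp: case_prod_beta)
  then show "(\<lambda>t. f t (z0 t + z t) - f t (z0 t) - D t (z0 t) (z t)) \<in> borel_measurable (lebesgue_on {a..b})"
    using z z0 by (intro borel_measurable_diff borel_measurable_superposition[OF cont_f] borel_measurable_add) auto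
next
  fix t assume "t \<in> space (lebesgue_on {a..b})"
  then have t: "t \<in> {a..b}"
    by simp
  show "f t (z0 t + 0) - f t (z0 t) - D t (z0 t) 0 = 0"
    using linear_0[OF has_derivative_linear[OF deriv[OF t]]] by simp
  show "((\<lambda>w. (f t (z0 t + w) - f t (z0 t) - D t (z0 t) w) / norm w) \<longlongrightarrow> 0) (at 0)"
    by (rule tendsto_rabs_zero_cancel) (use deriv[OF t, of "z0 t"] in \<open>simp add: has_derivative_at\<close>)
  show "(\<bar>f t (z0 t + w) - f t (z0 t) - D t (z0 t) w\<bar> / norm w) powr (q / (q - 1))
      \<le> (6 * K) powr (q / (q - 1)) * (1 + norm (z0 t) powr q)
        + (6 * K) powr (q / (q - 1)) * norm w powr q" for w
    by (rule remainder_quotient_le[OF t])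
qed (use q in auto)

lemmas integrable_remainder = Lq_remainder.integrable_R[OF Lq_remainder_increment]
  and integral_remainder_small = Lq_remainder.integral_R_small[OF Lq_remainder_increment]

end

end

text \<open>Splitting the norm of the pair costs 3^q, and each of the two integrals is at most the
  q-th power of the W^{1,q} norm. The resulting factor 2 is enlarged to 2^q, so that everything
  collects into the q-th power of 6.\<close>

lemma wderiv_pair_Lq_norm:
  assumes v: "v \<in> W1q q a b" and q: "1 < q"
  defines "z \<equiv> \<lambda>t. (v t, wderiv a b v t)"
  shows "z \<in> borel_measurable (lebesgue_on {a..b})"
    and "integrable (lebesgue_on {a..b}) (\<lambda>t. norm (z t) powr q)"
    and "(LINT t|lebesgue_on {a..b}. norm (z t) powr q) \<le> (6 * W1q_norm q a b v) powr q"
proof -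
  let ?M = "lebesgue_on {a..b}"
  have vLq: "v \<in> Lq q a b" "wderiv a b v \<in> Lq q a b"
    using v q wderiv_in_Lq(1)[OF v] by (auto simp: W1q_def)
  then have int: "integrable ?M (\<lambda>t. norm (v t) powr q)"
    "integrable ?M (\<lambda>t. norm (wderiv a b v t) powr q)"
    by (auto simp: Lq_def)
  show z: "z \<in> borel_measurable ?M"
    using vLq unfolding z_def Lq_def by (intro borel_measurable_Pair) auto
  have le: "norm (z t) powr q \<le> 3 powr q * (norm (v t) powr q + norm (wderiv a b v t) powr q)" for t
  proof -
    have "norm (z t) powr q \<le> (norm (v t) + norm (wderiv a b v t) + 0) powr q"
      using q norm_Pair_le unfolding z_def by (intro powr_mono2) auto
    then show ?thesis
      using powr_add3_le[of "norm (v t)" "norm (wderiv a b v t)" 0 q] q by simp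
  qed
  show "integrable ?M (\<lambda>t. norm (z t) powr q)"
  proof (rule Bochner_Integration.integrable_bound)
    show "integrable ?M (\<lambda>t. 3 powr q * (norm (v t) powr q + norm (wderiv a b v t) powr q))"
      using int by simp
    show "AE t in ?M. norm (norm (z t) powr q)
        \<le> norm (3 powr q * (norm (v t) powr q + norm (wderiv a b v t) powr q))"
      using le by (intro AE_I2) simp
  qed (use z in measurable)
  then have "(LINT t|?M. norm (z t) powr q)
      \<le> (LINT t|?M. 3 powr q * (norm (v t) powr q + norm (wderiv a b v t) powr q))"
    using int le by (intro integral_mono) auto
  also have "\<dots> = 3 powr q * ((LINT t|?M. norm (v t) powr q) + (LINT t|?M. norm (wderiv a b v t) powr q))"
    using int by simp
  also have "\<dots> \<le> 3 powr q * (W1q_norm q a b v powr q + W1q_norm q a b v powr q)"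
  proof -
    have root: "x = (x powr (1 / q)) powr q" if "x \<ge> 0" for x
      using that q by (simp add: powr_powr)
    have "(LINT t|?M. norm (v t) powr q) \<le> W1q_norm q a b v powr q"
      by (subst root) (use q in \<open>auto simp: W1q_norm_def intro!: powr_mono2\<close>)
    moreover have "(LINT t|?M. norm (wderiv a b v t) powr q) \<le> W1q_norm q a b v powr q"
      by (subst root) (use q in \<open>auto simp: W1q_norm_def intro!: powr_mono2\<close>)
    ultimately show ?thesis
      by (intro mult_left_mono add_mono) auto
  qed
  also have "\<dots> = 3 powr q * 2 powr 1 * W1q_norm q a b v powr q"
    by simp
  also have "\<dots> \<le> 3 powr q * 2 powr q * W1q_norm q a b v powr q"
    using q by (intro mult_right_mono mult_left_mono powr_mono) auto
  also have "\<dots> = (6 * W1q_norm q a b v) powr q"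
    using W1q_norm_nonneg[of q a b v] by (simp add: powr_mult flip: powr_mult[of 3 2])
  finally show "(LINT t|?M. norm (z t) powr q) \<le> (6 * W1q_norm q a b v) powr q" .
qed

section \<open>Differentiability of the scalar functional and vanishing of its first variation at a
  minimizer\<close>

locale variational_functional = growth_integrand a b q \<kappa> f D
  for a b q \<kappa> :: real and f :: "real \<Rightarrow> (real ^ 'n) \<times> (real ^ 'n) \<Rightarrow> real" and D +
  fixes y0 :: "real \<Rightarrow> real ^ 'n"
  assumes y0: "y0 \<in> W1q q a b"
    and int_f: "\<And>y. y \<in> W1q q a b \<Longrightarrow> integrable (lebesgue_on {a..b}) (\<lambda>t. f t (y t, wderiv a b y t))"
begin

definition "F y = (LINT t|lebesgue_on {a..b}. f t (y t, wderiv a b y t))"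

definition "first_variation v =
  (LINT t|lebesgue_on {a..b}. D t (y0 t, wderiv a b y0 t) (v t, wderiv a b v t))"

abbreviation "rem v t \<equiv>
  f t ((y0 t, wderiv a b y0 t) + (v t, wderiv a b v t)) - f t (y0 t, wderiv a b y0 t)
    - D t (y0 t, wderiv a b y0 t) (v t, wderiv a b v t)"

lemma integrable_rem:
  assumes "v \<in> W1q q a b"
  shows "integrable (lebesgue_on {a..b}) (rem v)"
  by (rule integrable_remainder[OF wderiv_pair_Lq_norm(1,2)[OF y0 q] wderiv_pair_Lq_norm(1,2)[OF assms q]])

lemma f_add_AE:
  assumes "v \<in> W1q q a b"
  shows "AE t in lebesgue_on {a..b}. f t (y0 t + v t, wderiv a b (\<lambda>t. y0 t + v t) t)
      = f t ((y0 t, wderiv a b y0 t) + (v t, wderiv a b v t))"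
  using W1q_add(2)[OF y0 assms less_imp_le[OF q]] by eventually_elim simp

lemma integrable_f_add:
  assumes "v \<in> W1q q a b"
  shows "integrable (lebesgue_on {a..b}) (\<lambda>t. f t ((y0 t, wderiv a b y0 t) + (v t, wderiv a b v t)))"
proof -
  have "(\<lambda>t. f t ((y0 t, wderiv a b y0 t) + (v t, wderiv a b v t)))
      \<in> borel_measurable (lebesgue_on {a..b})"
    by (intro borel_measurable_superposition[OF cont_f] borel_measurable_add
        wderiv_pair_Lq_norm(1)[OF y0 q] wderiv_pair_Lq_norm(1)[OF assms q])
  then show ?thesis
    by (rule Bochner_Integration.integrable_cong_AE_imp
        [OF int_f[OF W1q_add(1)[OF y0 assms less_imp_le[OF q]]] _ f_add_AE[OF assms]])
qed

text \<open>The linear term is the increment of f minus the remainder, and both are already known to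
  be integrable.\<close>

lemma integrable_first_variation:
  assumes "v \<in> W1q q a b"
  shows "integrable (lebesgue_on {a..b}) (\<lambda>t. D t (y0 t, wderiv a b y0 t) (v t, wderiv a b v t))"
proof -
  have "integrable (lebesgue_on {a..b}) (\<lambda>t. f t ((y0 t, wderiv a b y0 t) + (v t, wderiv a b v t))
      - f t (y0 t, wderiv a b y0 t) - rem v t)"
    by (intro Bochner_Integration.integrable_diff integrable_f_add int_f integrable_rem y0 assms)
  then show ?thesis
    by simp
qed

text \<open>Linearity of D is pointwise, but \<open>wderiv\<close> commutes with the scalar only
  almost everywhere, so the integrands are compared up to a null set.\<close>

lemma first_variation_scaleR:
  assumes v: "v \<in> W1q q a b"
  shows "first_variation (\<lambda>t. c *\<^sub>R v t) = c * first_variation v"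
proof -
  let ?M = "lebesgue_on {a..b}" and ?D = "\<lambda>t. D t (y0 t, wderiv a b y0 t)"
  note cv = W1q_scaleR[OF v less_imp_le[OF q], of c]
  have lin: "?D t (c *\<^sub>R w) = c * ?D t w" if "t \<in> space ?M" for t w
    using linear_scale[OF has_derivative_linear[OF deriv]] that by auto
  have "first_variation (\<lambda>t. c *\<^sub>R v t) = (LINT t|?M. c * ?D t (v t, wderiv a b v t))"
    unfolding first_variation_def
  proof (rule integral_cong_AE)
    show "AE t in ?M. ?D t (c *\<^sub>R v t, wderiv a b (\<lambda>t. c *\<^sub>R v t) t) = c * ?D t (v t, wderiv a b v t)"
      using cv(2) AE_space
    proof eventually_elim
      case (elim t)
      then show ?case
        using lin[OF elim(2), of "(v t, wderiv a b v t)"] by simp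
    qed
  qed (use integrable_first_variation[OF v] integrable_first_variation[OF cv(1)] in auto)
  then show ?thesis
    by (simp add: first_variation_def)
qed

lemma F_increment_eq:
  assumes v: "v \<in> W1q q a b"
  shows "F (\<lambda>t. y0 t + v t) - F y0 - first_variation v = (LINT t|lebesgue_on {a..b}. rem v t)"
proof -
  have "F (\<lambda>t. y0 t + v t)
      = (LINT t|lebesgue_on {a..b}. f t ((y0 t, wderiv a b y0 t) + (v t, wderiv a b v t)))"
    unfolding F_def
    by (intro integral_cong_AE f_add_AE[OF v] borel_measurable_integrable integrable_f_add[OF v]
        int_f W1q_add(1)[OF y0 v less_imp_le[OF q]])
  then show ?thesis
    using integrable_f_add[OF v] int_f[OF y0] integrable_first_variation[OF v]
    by (simp add: F_def first_variation_def del: add_Pair)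
qed

lemma F_differentiable:
  assumes "e > 0"
  shows "\<exists>\<delta>>0. \<forall>v \<in> W1q q a b. W1q_norm q a b v < \<delta> \<longrightarrow>
    \<bar>F (\<lambda>t. y0 t + v t) - F y0 - first_variation v\<bar> \<le> e * W1q_norm q a b v"
proof -
  let ?M = "lebesgue_on {a..b}"
  \<comment> \<open>The L^q norm of the pair is at most six times the W^{1,q} norm; hence e and
    later \<delta> are divided by 6.\<close>
  have "e / 6 > 0"
    using assms by simp
  from integral_remainder_small[OF wderiv_pair_Lq_norm(1,2)[OF y0 q] this]
  obtain \<delta> where \<delta>: "\<delta> > 0" and small: "\<And>d z. 0 < d \<Longrightarrow> d < \<delta> \<Longrightarrow> z \<in> borel_measurable ?M \<Longrightarrow>
      integrable ?M (\<lambda>t. norm (z t) powr q) \<Longrightarrow> (LINT t|?M. norm (z t) powr q) \<le> d powr q \<Longrightarrow>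
      \<bar>LINT t|?M. f t ((y0 t, wderiv a b y0 t) + z t) - f t (y0 t, wderiv a b y0 t)
        - D t (y0 t, wderiv a b y0 t) (z t)\<bar> \<le> e / 6 * d"
    by blast
  have "\<bar>F (\<lambda>t. y0 t + v t) - F y0 - first_variation v\<bar> \<le> e * W1q_norm q a b v"
    if v: "v \<in> W1q q a b" and less: "W1q_norm q a b v < \<delta> / 6" for v
  proof -
    note z = wderiv_pair_Lq_norm[OF v q]
    have "\<bar>LINT t|?M. rem v t\<bar> / (e / 6) \<le> 6 * W1q_norm q a b v"
    \<comment> \<open>The estimate requires a positive \<open>d\<close>, while the norm of v may be
      0. It is applied to every d strictly between six times the norm and \<delta>, and the bound
      survives the passage to the lower end.\<close>
    proof (rule dense_ge_bounded)
      show "6 * W1q_norm q a b v < \<delta>"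
        using less by simp
      fix d assume d: "6 * W1q_norm q a b v < d" "d < \<delta>"
      then have "0 < d"
        using W1q_norm_nonneg[of q a b v] by linarith
      have "(6 * W1q_norm q a b v) powr q \<le> d powr q"
        using d q W1q_norm_nonneg[of q a b v] by (intro powr_mono2) auto
      with z(3) have "(LINT t|?M. norm (v t, wderiv a b v t) powr q) \<le> d powr q"
        by linarith
      from small[OF \<open>0 < d\<close> d(2) z(1,2) this]
      show "\<bar>LINT t|?M. rem v t\<bar> / (e / 6) \<le> d"
        using assms by (simp add: field_simps)
    qed
    then show ?thesis
      unfolding F_increment_eq[OF v] using assms by (simp add: field_simps)
  qed
  then show ?thesis
    using \<delta> by (intro exI[of _ "\<delta> / 6"]) auto
qed

lemma first_variation_nonneg_if_minimizer:
  assumes min: "\<And>v. v \<in> W1q_0 q a b \<Longrightarrow> F y0 \<le> F (\<lambda>t. y0 t + v t)"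
    and v: "v \<in> W1q_0 q a b"
  shows "0 \<le> first_variation v"
proof (rule ccontr)
  assume neg: "\<not> 0 \<le> first_variation v"
  define n where "n = W1q_norm q a b v"
  have n: "n \<ge> 0"
    by (simp add: n_def W1q_norm_nonneg)
  \<comment> \<open>The \<open>n + 1\<close> here and in \<open>s\<close> keeps the denominator
    positive when v has norm 0 and makes the inequalities for \<open>e * n\<close> and
    \<open>s * n\<close> strict.\<close>
  define e where "e = - first_variation v / (n + 1)"
  have e: "e > 0" "e * n < - first_variation v"
    using neg n by (auto simp: e_def field_simps)
  obtain \<delta> where \<delta>: "\<delta> > 0" "\<And>v. v \<in> W1q q a b \<Longrightarrow> W1q_norm q a b v < \<delta> \<Longrightarrow>
      \<bar>F (\<lambda>t. y0 t + v t) - F y0 - first_variation v\<bar> \<le> e * W1q_norm q a b v"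
    using F_differentiable[OF e(1)] by blast
  define s where "s = \<delta> / (n + 1)"
  have s: "s > 0" "s * n < \<delta>"
    using \<delta>(1) n by (auto simp: s_def field_simps)
  have vW: "v \<in> W1q q a b"
    using v by (simp add: W1q_0_def)
  have norm: "W1q_norm q a b (\<lambda>t. s *\<^sub>R v t) = s * n"
    using W1q_norm_scaleR[OF vW less_imp_le[OF q]] s(1) by (simp add: n_def)
  have "\<bar>F (\<lambda>t. y0 t + s *\<^sub>R v t) - F y0 - first_variation (\<lambda>t. s *\<^sub>R v t)\<bar> \<le> e * (s * n)"
    using \<delta>(2)[OF W1q_scaleR(1)[OF vW less_imp_le[OF q], of s]] s(2) by (simp add: norm)
  moreover have "F y0 \<le> F (\<lambda>t. y0 t + s *\<^sub>R v t)"
    by (intro min W1q_0_scaleR v less_imp_le[OF q])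
  ultimately have "0 \<le> s * first_variation v + e * (s * n)"
    unfolding first_variation_scaleR[OF vW] by linarith
  also have "\<dots> = s * (first_variation v + e * n)"
    by (simp add: algebra_simps)
  finally show False
    using s(1) e(2) by (simp add: zero_le_mult_iff)
qed

lemma F_le_if_minimizer:
  assumes min: "\<And>v. v \<in> W1q_0 q a b \<Longrightarrow> F y0 \<le> F (\<lambda>t. y0 t + v t)" and "e > 0"
  shows "\<exists>\<delta>>0. \<forall>v \<in> W1q_0 q a b. W1q_norm q a b v < \<delta> \<longrightarrow>
    F (\<lambda>t. y0 t + v t) \<le> F y0 + e * W1q_norm q a b v"
proof -
  have zero: "first_variation v = 0" if v: "v \<in> W1q_0 q a b" for v
  proof -
    have "0 \<le> first_variation (\<lambda>t. (-1) *\<^sub>R v t)"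
      by (intro first_variation_nonneg_if_minimizer[OF min] W1q_0_scaleR[OF v less_imp_le[OF q]])
    moreover have "v \<in> W1q q a b"
      using v by (simp add: W1q_0_def)
    ultimately show ?thesis
      using first_variation_nonneg_if_minimizer[OF min v] first_variation_scaleR[of v "-1"]
      by linarith
  qed
  obtain \<delta> where \<delta>: "\<delta> > 0" "\<And>v. v \<in> W1q q a b \<Longrightarrow> W1q_norm q a b v < \<delta> \<Longrightarrow>
      \<bar>F (\<lambda>t. y0 t + v t) - F y0 - first_variation v\<bar> \<le> e * W1q_norm q a b v"
    using F_differentiable[OF \<open>e > 0\<close>] by blast
  have "F (\<lambda>t. y0 t + v t) \<le> F y0 + e * W1q_norm q a b v"
    if "v \<in> W1q_0 q a b" "W1q_norm q a b v < \<delta>" for v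
    using \<delta>(2)[of v] that zero[of v] by (auto simp: W1q_0_def)
  then show ?thesis
    using \<delta>(1) by blast
qed

end


section \<open>The inf-translation\<close>

lemma has_derivative_eq_grad:
  fixes f :: "'a::euclidean_space \<Rightarrow> real"
  assumes "(f has_derivative l) (at x)"
  shows "l h = h \<bullet> grad f x"
proof -
  \<comment> \<open>The Riesz vector of a linear functional is its adjoint applied to 1; it is the
    candidate for the definite description in \<open>grad\<close>.\<close>
  have l: "l = (\<lambda>h. h \<bullet> adjoint l 1)"
    using adjoint_works[OF has_derivative_linear[OF assms], of _ 1] by auto
  have "grad f x = adjoint l 1"
    unfolding grad_def
  proof (rule the_equality)
    show "GDERIV f x :> adjoint l 1"
      using assms l by (simp add: gderiv_def)
    fix D assume "GDERIV f x :> D"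
    then have "(\<lambda>h. h \<bullet> D) = l"
      using assms by (auto simp: gderiv_def intro: has_derivative_unique)
    then have "\<forall>h. h \<bullet> D = h \<bullet> adjoint l 1"
      using l by metis
    then show "D = adjoint l 1"
      by (simp only: vector_eq_ldot)
  qed
  then show ?thesis
    using l by metis
qed

text \<open>At t = a or t = b the derivative in t is one-sided, but y and p range over the whole
  space. Restricting to the slice of fixed t therefore gives unrestricted derivatives in (y,
  p).\<close>

lemma C1_on_partial_derivatives:
  fixes L :: "real \<Rightarrow> 'y::euclidean_space \<Rightarrow> 'p::euclidean_space \<Rightarrow> real ^ 'd"
  assumes der: "((\<lambda>(t, y, p). L t y p) has_derivative L') (at (t, y, p) within {a..b} \<times> UNIV \<times> UNIV)"
    and t: "t \<in> {a..b}"
  shows "((\<lambda>z. L t (fst z) (snd z)) has_derivative (\<lambda>w. L' (0, w))) (at (y, p))"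
    and "((\<lambda>y'. L t y' p $ i) has_derivative (\<lambda>u. L' (0, u, 0) $ i)) (at y)"
    and "((\<lambda>p'. L t y p' $ i) has_derivative (\<lambda>u. L' (0, 0, u) $ i)) (at p)"
proof -
  have "((\<lambda>z. (t, z)) has_derivative (\<lambda>w. (0, w))) (at (y, p))"
    by (auto intro!: derivative_eq_intros)
  moreover have "((\<lambda>(t, y, p). L t y p) has_derivative L') (at (t, y, p) within range (Pair t))"
    using t by (intro has_derivative_subset[OF der]) auto
  ultimately have "((\<lambda>z. (\<lambda>(t, y, p). L t y p) (t, z)) has_derivative (\<lambda>w. L' (0, w))) (at (y, p))"
    by (rule has_derivative_in_compose)
  then show z: "((\<lambda>z. L t (fst z) (snd z)) has_derivative (\<lambda>w. L' (0, w))) (at (y, p))"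
    by (simp add: case_prod_beta)
  have "((\<lambda>y'. (y', p)) has_derivative (\<lambda>u. (u, 0))) (at y)"
    by (auto intro!: derivative_eq_intros)
  from bounded_linear.has_derivative[OF bounded_linear_vec_nth has_derivative_compose[OF this z], of i]
  show "((\<lambda>y'. L t y' p $ i) has_derivative (\<lambda>u. L' (0, u, 0) $ i)) (at y)"
    by simp
  have "((\<lambda>p'. (y, p')) has_derivative (\<lambda>u. (0, u))) (at p)"
    by (auto intro!: derivative_eq_intros)
  from bounded_linear.has_derivative[OF bounded_linear_vec_nth has_derivative_compose[OF this z], of i]
  show "((\<lambda>p'. L t y p' $ i) has_derivative (\<lambda>u. L' (0, 0, u) $ i)) (at p)"
    by simp
qed

lemma C1_on_imp_continuous_on:
  assumes "C1_on S f"
  shows "continuous_on S f"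
proof -
  obtain f' where "\<And>x. x \<in> S \<Longrightarrow> (f has_derivative blinfun_apply (f' x)) (at x within S)"
    using assms unfolding C1_on_def by blast
  then show ?thesis
    by (rule has_derivative_continuous_on)
qed

lemma C1_on_imp_growth_integrand:
  fixes L :: "real \<Rightarrow> real ^ 'n \<Rightarrow> real ^ 'n \<Rightarrow> real ^ 'd" and \<zeta> :: "real ^ 'd"
  assumes ab: "a \<le> b" and q: "1 < q"
    and C1: "C1_on ({a..b} \<times> UNIV \<times> UNIV) (\<lambda>(t, y, p). L t y p)"
    and grad_p: "\<And>i t y p. t \<in> {a..b} \<Longrightarrow>
           norm (grad (\<lambda>p'. L t y p' $ i) p) \<le> K * (norm y powr (q - 1) + norm p powr (q - 1) + 1)"
    and grad_y: "\<And>i t y p. t \<in> {a..b} \<Longrightarrow>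
           norm (grad (\<lambda>y'. L t y' p $ i) y) \<le> K * (norm y powr (q - 1) + norm p powr (q - 1) + 1)"
  obtains \<kappa> D where "growth_integrand a b q \<kappa> (\<lambda>t z. \<zeta> \<bullet> L t (fst z) (snd z)) D"
proof -
  let ?S = "{a..b} \<times> UNIV \<times> UNIV :: (real \<times> (real ^ 'n) \<times> (real ^ 'n)) set"
  obtain L' where L': "\<And>x. x \<in> ?S \<Longrightarrow>
      ((\<lambda>(t, y, p). L t y p) has_derivative blinfun_apply (L' x)) (at x within ?S)"
    and cont_L': "continuous_on ?S L'"
    using C1 unfolding C1_on_def by blast
  define D where "D t z w = \<zeta> \<bullet> blinfun_apply (L' (t, z)) (0, w)" for t z w
  \<comment> \<open>One factor 2 counts the gradients in y and p; the other replaces the two powers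
    in each bound by |z|^(q - 1) + 1. The sum over \<zeta> passes from components of L to \<zeta>
    \<bullet> L.\<close>
  define \<kappa> where "\<kappa> = (\<Sum>i\<in>UNIV. \<bar>\<zeta> $ i\<bar>) * (4 * K)"
  \<comment> \<open>At t = a and y = p = 0 the gradient bound reads exactly K, because both powers
    vanish.\<close>
  have K: "0 \<le> K"
    using order.trans[OF norm_ge_zero grad_p[of a 0 _ 0]] ab by simp
  have "growth_integrand a b q \<kappa> (\<lambda>t z. \<zeta> \<bullet> L t (fst z) (snd z)) D"
  proof
    show "1 < q" by (rule q)
    show "0 \<le> \<kappa>"
      using K by (auto simp: \<kappa>_def intro!: mult_nonneg_nonneg sum_nonneg)
    show "continuous_on ({a..b} \<times> UNIV) (\<lambda>(t, z). \<zeta> \<bullet> L t (fst z) (snd z))"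
      using C1_on_imp_continuous_on[OF C1] by (auto simp: case_prod_beta intro!: continuous_intros)
    have "continuous_on ({a..b} \<times> UNIV) (\<lambda>x :: real \<times> ((real ^ 'n) \<times> (real ^ 'n)) \<times> ((real ^ 'n) \<times> (real ^ 'n)).
        L' (fst x, fst (snd x)))"
      by (rule continuous_on_compose2[OF cont_L']) (auto intro!: continuous_intros)
    then show "continuous_on ({a..b} \<times> UNIV) (\<lambda>(t, z, w). D t z w)"
      unfolding D_def case_prod_beta
      by (intro continuous_intros bounded_bilinear.continuous_on[OF bounded_bilinear_blinfun_apply])
  next
    fix t and z w :: "(real ^ 'n) \<times> (real ^ 'n)" assume t: "t \<in> {a..b}"
    obtain y p where z: "z = (y, p)"
      by (cases z)
    obtain u r where w: "w = (u, r)"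
      by (cases w)
    have der: "((\<lambda>(t, y, p). L t y p) has_derivative blinfun_apply (L' (t, z))) (at (t, y, p) within ?S)"
      unfolding z using t by (intro L') auto
    note part = C1_on_partial_derivatives[OF der t]
    show "((\<lambda>z. \<zeta> \<bullet> L t (fst z) (snd z)) has_derivative D t z) (at z)"
      using has_derivative_inner_right[OF part(1), of \<zeta>] unfolding D_def[abs_def] z .
    have le: "norm y \<le> norm z" "norm p \<le> norm z" "norm u \<le> norm w" "norm r \<le> norm w"
      by (auto simp: z w norm_Pair real_le_rsqrt)
    have comp: "\<bar>blinfun_apply (L' (t, z)) (0, w) $ i\<bar> \<le> 4 * K * (norm z powr (q - 1) + 1) * norm w" for i
    proof -
      let ?g = "K * (norm y powr (q - 1) + norm p powr (q - 1) + 1)"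
      have "norm y powr (q - 1) \<le> norm z powr (q - 1)" "norm p powr (q - 1) \<le> norm z powr (q - 1)"
        using le q by (auto intro!: powr_mono2)
      then have g: "?g \<le> K * (2 * (norm z powr (q - 1) + 1))"
        using K by (intro mult_left_mono) auto
      have g0: "0 \<le> ?g"
        using K by simp
      have "(0, w) = (0::real, u, 0) + (0, 0, r)"
        by (simp add: w)
      then have "blinfun_apply (L' (t, z)) (0, w) $ i
          = blinfun_apply (L' (t, z)) (0, u, 0) $ i + blinfun_apply (L' (t, z)) (0, 0, r) $ i"
        by (simp add: blinfun.add_right del: add_Pair)
      also have "\<dots> = u \<bullet> grad (\<lambda>y'. L t y' p $ i) y + r \<bullet> grad (\<lambda>p'. L t y p' $ i) p"
        using has_derivative_eq_grad[OF part(2)] has_derivative_eq_grad[OF part(3)] by simp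
      also have "\<bar>\<dots>\<bar> \<le> norm u * norm (grad (\<lambda>y'. L t y' p $ i) y) + norm r * norm (grad (\<lambda>p'. L t y p' $ i) p)"
        by (intro order.trans[OF abs_triangle_ineq] add_mono Cauchy_Schwarz_ineq2)
      also have "\<dots> \<le> norm w * ?g + norm w * ?g"
        using t le g0 by (intro add_mono mult_mono grad_y grad_p) auto
      also have "\<dots> \<le> norm w * (K * (2 * (norm z powr (q - 1) + 1))) + norm w * (K * (2 * (norm z powr (q - 1) + 1)))"
        by (intro add_mono mult_left_mono[OF g]) auto
      finally show ?thesis
        by (simp add: algebra_simps)
    qed
    have "\<bar>D t z w\<bar> \<le> (\<Sum>i\<in>UNIV. \<bar>\<zeta> $ i * blinfun_apply (L' (t, z)) (0, w) $ i\<bar>)"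
      by (simp add: D_def inner_vec_def)
    also have "\<dots> \<le> (\<Sum>i\<in>UNIV. \<bar>\<zeta> $ i\<bar> * (4 * K * (norm z powr (q - 1) + 1) * norm w))"
      unfolding abs_mult by (intro sum_mono mult_left_mono comp) auto
    also have "\<dots> = \<kappa> * (norm z powr (q - 1) + 1) * norm w"
      by (simp add: \<kappa>_def mult.assoc flip: sum_distrib_right)
    finally show "\<bar>D t z w\<bar> \<le> \<kappa> * (norm z powr (q - 1) + 1) * norm w" .
  qed
  then show thesis
    by (rule that)
qed

lemma integrable_Lagrangian:
  fixes L :: "real \<Rightarrow> real ^ 'n \<Rightarrow> real ^ 'n \<Rightarrow> real ^ 'd"
  assumes q: "1 < q" and cont: "continuous_on ({a..b} \<times> UNIV \<times> UNIV) (\<lambda>(t, y, p). L t y p)"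
    and bound: "\<And>i t y p. t \<in> {a..b} \<Longrightarrow> \<bar>L t y p $ i\<bar> \<le> K * (norm y powr q + norm p powr q + 1)"
    and y: "y \<in> W1q q a b"
  shows "integrable (lebesgue_on {a..b}) (\<lambda>t. L t (y t) (wderiv a b y t))"
proof (rule Bochner_Integration.integrable_bound)
  let ?h = "\<lambda>t. real CARD('d) * (K * (norm (y t) powr q + norm (wderiv a b y t) powr q + 1))"
  have "integrable (lebesgue_on {a..b}) (\<lambda>t. norm (y t) powr q)"
    "integrable (lebesgue_on {a..b}) (\<lambda>t. norm (wderiv a b y t) powr q)"
    using y q wderiv_in_Lq(1)[OF y] by (auto simp: W1q_def Lq_def)
  then show "integrable (lebesgue_on {a..b}) ?h"
    by (intro integrable_mult_right Bochner_Integration.integrable_add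
        finite_measure.integrable_const[OF finite_measure_lebesgue_on_Icc])
  have "continuous_on ({a..b} \<times> UNIV) (\<lambda>(t, z). L t (fst z) (snd z))"
    using cont by (simp add: case_prod_beta)
  from borel_measurable_superposition[OF this wderiv_pair_Lq_norm(1)[OF y q]]
  show "(\<lambda>t. L t (y t) (wderiv a b y t)) \<in> borel_measurable (lebesgue_on {a..b})"
    by simp
  show "AE t in lebesgue_on {a..b}. norm (L t (y t) (wderiv a b y t)) \<le> norm (?h t)"
  proof (rule AE_I2)
    fix t assume "t \<in> space (lebesgue_on {a..b})"
    then have "t \<in> {a..b}"
      by simp
    have "norm (L t (y t) (wderiv a b y t)) \<le> (\<Sum>i\<in>UNIV. \<bar>L t (y t) (wderiv a b y t) $ i\<bar>)"
      by (rule norm_le_l1_cart)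
    also have "\<dots> \<le> (\<Sum>i\<in>(UNIV::'d set). K * (norm (y t) powr q + norm (wderiv a b y t) powr q + 1))"
      by (intro sum_mono bound \<open>t \<in> {a..b}\<close>)
    also have "\<dots> = ?h t"
      by simp
    finally show "norm (L t (y t) (wderiv a b y t)) \<le> norm (?h t)"
      by simp
  qed
qed

section \<open>Frechet derivative and set-valued derivative from a one-sided estimate\<close>

lemma has_frechet_deriv_at_0_zero:
  fixes \<phi> :: "(real \<Rightarrow> real ^ 'n) \<Rightarrow> real"
  assumes f: "\<And>v. v \<in> W1q_0 q a b \<Longrightarrow> f v = ereal (\<phi> v)"
    and min: "\<And>v. v \<in> W1q_0 q a b \<Longrightarrow> \<phi> (\<lambda>_. 0) \<le> \<phi> v"
    and small: "\<And>e. e > 0 \<Longrightarrow> \<exists>\<delta>>0. \<forall>v \<in> W1q_0 q a b. W1q_norm q a b v < \<delta> \<longrightarrow>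
      \<phi> v \<le> \<phi> (\<lambda>_. 0) + e * W1q_norm q a b v"
  shows "has_frechet_deriv_at_0 q a b f (\<lambda>_. 0)"
proof -
  have "\<exists>\<delta>>0. \<forall>v \<in> W1q_0 q a b. W1q_norm q a b v < \<delta> \<longrightarrow>
      \<bar>f v - f (\<lambda>_. 0) - ereal 0\<bar> \<le> ereal (e * W1q_norm q a b v)" if e: "e > 0" for e
  proof -
    obtain \<delta> where "\<delta> > 0" and \<delta>: "\<And>v. v \<in> W1q_0 q a b \<Longrightarrow> W1q_norm q a b v < \<delta> \<Longrightarrow>
        \<phi> v \<le> \<phi> (\<lambda>_. 0) + e * W1q_norm q a b v"
      using small[OF e] by blast
    have "\<bar>f v - f (\<lambda>_. 0) - ereal 0\<bar> \<le> ereal (e * W1q_norm q a b v)"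
      if "v \<in> W1q_0 q a b" "W1q_norm q a b v < \<delta>" for v
      using \<delta>[OF that] min[OF that(1)] that by (simp add: f W1q_0_0)
    then show ?thesis
      using \<open>\<delta> > 0\<close> by blast
  qed
  then show ?thesis
    unfolding has_frechet_deriv_at_0_def by (auto simp: f W1q_0_0 intro!: exI[of _ 0])
qed

text \<open>Two derivatives approximate the same increment along s v; by homogeneity the factor s
  cancels from the comparison. This fixes the chosen \<open>frechet_deriv_at_0\<close> on
  \<open>W1q_0\<close>.\<close>

lemma has_frechet_deriv_at_0_unique:
  assumes q: "1 \<le> q" and \<xi>: "has_frechet_deriv_at_0 q a b f \<xi>" and \<eta>: "has_frechet_deriv_at_0 q a b f \<eta>"
    and v: "v \<in> W1q_0 q a b"
  shows "\<xi> v = \<eta> v"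
proof -
  define n where "n = W1q_norm q a b v"
  have n: "n \<ge> 0"
    by (simp add: n_def W1q_norm_nonneg)
  have "\<bar>\<xi> v - \<eta> v\<bar> \<le> 0 + e" if "e > 0" for e
  proof -
    define e' where "e' = e / (2 * (n + 1))"
    have e': "e' > 0" "2 * e' * n \<le> e"
      using that n by (auto simp: e'_def field_simps)
    obtain \<delta>1 where \<delta>1: "\<delta>1 > 0" and d1: "\<And>v. v \<in> W1q_0 q a b \<Longrightarrow> W1q_norm q a b v < \<delta>1 \<Longrightarrow>
        \<bar>f v - f (\<lambda>_. 0) - ereal (\<xi> v)\<bar> \<le> ereal (e' * W1q_norm q a b v)"
      using \<xi> e'(1) unfolding has_frechet_deriv_at_0_def by blast
    obtain \<delta>2 where \<delta>2: "\<delta>2 > 0" and d2: "\<And>v. v \<in> W1q_0 q a b \<Longrightarrow> W1q_norm q a b v < \<delta>2 \<Longrightarrow>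
        \<bar>f v - f (\<lambda>_. 0) - ereal (\<eta> v)\<bar> \<le> ereal (e' * W1q_norm q a b v)"
      using \<eta> e'(1) unfolding has_frechet_deriv_at_0_def by blast
    define s where "s = min \<delta>1 \<delta>2 / (n + 1)"
    have s: "s > 0" "s * n < \<delta>1" "s * n < \<delta>2"
    proof -
      show "s > 0"
        using \<delta>1 \<delta>2 n by (simp add: s_def)
      then have "s * n < s * (n + 1)"
        by simp
      also have "\<dots> = min \<delta>1 \<delta>2"
        using n by (simp add: s_def)
      finally show "s * n < \<delta>1" "s * n < \<delta>2"
        by simp_all
    qed
    let ?sv = "\<lambda>t. s *\<^sub>R v t"
    have sv: "?sv \<in> W1q_0 q a b" "W1q_norm q a b ?sv = s * n"
      using v q s(1) W1q_0_scaleR[OF v q] W1q_norm_scaleR[of v q a b s] by (auto simp: n_def W1q_0_def)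
    have lin: "\<xi> ?sv = s * \<xi> v" "\<eta> ?sv = s * \<eta> v"
      using \<xi> \<eta> v unfolding has_frechet_deriv_at_0_def by blast+
    have fin: "\<bar>f (\<lambda>_. 0)\<bar> \<noteq> \<infinity>"
      using \<xi> unfolding has_frechet_deriv_at_0_def by (elim conjE)
    have "\<bar>f ?sv - f (\<lambda>_. 0) - ereal (s * \<xi> v)\<bar> \<le> ereal (e' * (s * n))"
      "\<bar>f ?sv - f (\<lambda>_. 0) - ereal (s * \<eta> v)\<bar> \<le> ereal (e' * (s * n))"
      using d1[OF sv(1)] d2[OF sv(1)] s by (simp_all add: sv(2) lin)
    then have "\<bar>s * \<xi> v - s * \<eta> v\<bar> \<le> 2 * (e' * (s * n))"
      \<comment> \<open>With f finite at 0, an infinite value at s v would violate the extended-real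
        estimates, so the comparison takes place among reals.\<close>
      using fin by (cases "f ?sv"; cases "f (\<lambda>_. 0)") (auto simp: abs_if split: if_splits)
    also have "\<dots> = s * (2 * e' * n)"
      by simp
    also have "\<dots> \<le> s * e"
      using e'(2) s(1) by (intro mult_left_mono) auto
    finally have "s * \<bar>\<xi> v - \<eta> v\<bar> \<le> s * e"
      using s(1) by (simp add: abs_mult flip: right_diff_distrib)
    then show ?thesis
      using s(1) by simp
  qed
  then have "\<bar>\<xi> v - \<eta> v\<bar> \<le> 0"
    by (rule field_le_epsilon)
  then show ?thesis
    by simp
qed

lemma has_zeta_deriv_Hplus:
  fixes \<phi> :: "(real \<Rightarrow> real ^ 'n) \<Rightarrow> real" and \<zeta> :: "'a::real_inner"
  assumes q: "1 \<le> q" and \<zeta>: "\<zeta> \<noteq> 0"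
    and inf: "\<And>v. v \<in> W1q_0 q a b \<Longrightarrow> (INF z \<in> G v. ereal (\<zeta> \<bullet> z)) = ereal (\<phi> v)"
    and min: "\<And>v. v \<in> W1q_0 q a b \<Longrightarrow> \<phi> (\<lambda>_. 0) \<le> \<phi> v"
    and small: "\<And>e. e > 0 \<Longrightarrow> \<exists>\<delta>>0. \<forall>v \<in> W1q_0 q a b. W1q_norm q a b v < \<delta> \<longrightarrow>
      \<phi> v \<le> \<phi> (\<lambda>_. 0) + e * W1q_norm q a b v"
    and v: "v \<in> W1q_0 q a b"
  shows "has_zeta_deriv \<zeta> G (\<lambda>_. 0) v (Hplus \<zeta>)"
  unfolding has_zeta_deriv_def has_set_lim_at_right_0_def
proof (intro allI impI, elim conjE)
  fix s :: "nat \<Rightarrow> real" assume "\<forall>k. s k > 0" and s0: "s \<longlonglongrightarrow> 0"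
  then have s: "s k > 0" for k
    by blast
  define n where "n = W1q_norm q a b v"
  have n: "n \<ge> 0"
    by (simp add: n_def W1q_norm_nonneg)
  have sv: "(\<lambda>t. s k *\<^sub>R v t) \<in> W1q_0 q a b" "W1q_norm q a b (\<lambda>t. s k *\<^sub>R v t) = s k * n" for k
    using v q s[of k] W1q_0_scaleR[OF v q] W1q_norm_scaleR[of v q a b "s k"] by (auto simp: n_def W1q_0_def)
  define c where "c k = (\<phi> (\<lambda>t. s k *\<^sub>R v t) - \<phi> (\<lambda>_. 0)) / s k" for k
  have "c \<longlonglongrightarrow> 0"
  proof (rule LIMSEQ_I)
    fix e :: real assume "e > 0"
    define e' where "e' = e / (n + 1)"
    have e': "e' > 0" "e' * n < e"
      using \<open>e > 0\<close> n by (auto simp: e'_def field_simps)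
    obtain \<delta> where "\<delta> > 0" and \<delta>: "\<And>v. v \<in> W1q_0 q a b \<Longrightarrow> W1q_norm q a b v < \<delta> \<Longrightarrow>
        \<phi> v \<le> \<phi> (\<lambda>_. 0) + e' * W1q_norm q a b v"
      using small[OF e'(1)] by blast
    have "(\<lambda>k. s k * n) \<longlonglongrightarrow> 0 * n"
      by (intro tendsto_intros s0)
    then have "\<forall>\<^sub>F k in sequentially. s k * n < \<delta>"
      using \<open>\<delta> > 0\<close> by (intro order_tendstoD(2)) auto
    then obtain N where N: "\<And>k. k \<ge> N \<Longrightarrow> s k * n < \<delta>"
      unfolding eventually_sequentially by blast
    have "norm (c k - 0) < e" if "k \<ge> N" for k
    proof -
      \<comment> \<open>The norm of s v is s n, so the first-order error divided by s is
        \<open>e' * n\<close>, the same for all k.\<close>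
      have "c k \<le> (e' * (s k * n)) / s k"
        using \<delta>[OF sv(1)[of k]] N[OF that] s[of k] unfolding c_def
        by (intro divide_right_mono) (auto simp: sv(2))
      also have "\<dots> = e' * n"
        using s[of k] by simp
      finally have "c k < e"
        using e'(2) by simp
      moreover have "c k \<ge> 0"
        using min[OF sv(1)[of k]] s[of k] by (simp add: c_def)
      ultimately show ?thesis
        by simp
    qed
    then show "\<exists>N. \<forall>k\<ge>N. norm (c k - 0) < e"
      by blast
  qed
  have "(\<lambda>z. (1 / s k) *\<^sub>R z) ` zeta_diff \<zeta> (G (\<lambda>t. 0 + s k *\<^sub>R v t)) (G (\<lambda>_. 0)) = {z. \<zeta> \<bullet> z \<ge> c k}" for k
    using zeta_diff_eq_halfspace[OF \<zeta> inf[OF sv(1)[of k]] inf[OF W1q_0_0]]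
      scaleR_image_halfspace[OF s[of k]] by (simp add: c_def)
  then show "set_seq_lim (\<lambda>k. (\<lambda>z. (1 / s k) *\<^sub>R z) ` zeta_diff \<zeta> (G (\<lambda>t. 0 + s k *\<^sub>R v t)) (G (\<lambda>_. 0)))
      = Hplus \<zeta>"
    using set_seq_lim_halfspaces[OF \<zeta> \<open>c \<longlonglongrightarrow> 0\<close>] by (simp add: Hplus_def)
qed

text \<open>For the lower bound, a halfspace is closed and convex, so it contains
  \<open>Jhat\<close> once it contains the shifted cones, which holds as \<zeta> is nonnegative on
  C. For the upper bound, 0 in C makes the value of J at y0 + v itself a point of
  \<open>Jhat\<close>.\<close>

lemma phi_bounds:
  assumes C: "convex_cone C" and \<zeta>: "\<zeta> \<in> dual_cone C" and "y0 \<in> M"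
    and lower: "\<And>y. y \<in> M \<Longrightarrow> m \<le> Jzeta a b L \<zeta> (\<lambda>t. y t + v t)"
  shows "ereal m \<le> phi a b L C \<zeta> M v" "phi a b L C \<zeta> M v \<le> ereal (Jzeta a b L \<zeta> (\<lambda>t. y0 t + v t))"
proof -
  have "Jhat a b L C M v \<subseteq> {z. \<zeta> \<bullet> z \<ge> m}"
    unfolding Jhat_def cl_co_def
  proof (intro closure_minimal hull_minimal)
    show "(\<Union>y\<in>M. Jbar a b L C (\<lambda>t. y t + v t)) \<subseteq> {z. \<zeta> \<bullet> z \<ge> m}"
      using lower \<zeta> by (force simp: Jbar_def Jzeta_def dual_cone_def inner_right_distrib intro: add_increasing2)
  qed (auto intro: convex_halfspace_ge closed_halfspace_ge)
  then show "ereal m \<le> phi a b L C \<zeta> M v"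
    unfolding phi_def by (intro INF_greatest) auto
  have "0 \<in> C"
    using C by (simp add: convex_cone_contains_0)
  then have "J a b L (\<lambda>t. y0 t + v t) \<in> (\<Union>y\<in>M. Jbar a b L C (\<lambda>t. y t + v t))"
    using \<open>y0 \<in> M\<close> by (force simp: Jbar_def)
  then have "J a b L (\<lambda>t. y0 t + v t) \<in> Jhat a b L C M v"
    unfolding Jhat_def cl_co_def by (meson closure_subset hull_inc subsetD)
  then show "phi a b L C \<zeta> M v \<le> ereal (Jzeta a b L \<zeta> (\<lambda>t. y0 t + v t))"
    unfolding phi_def Jzeta_def by (rule INF_lower)
qed

theorem corollary4p2:
  fixes a b q K1 K2 :: real
    and A B :: "real ^ 'n"
    and C :: "(real ^ 'd) set"
    and L :: "real \<Rightarrow> real ^ 'n \<Rightarrow> real ^ 'n \<Rightarrow> real ^ 'd"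
    and M :: "(real \<Rightarrow> real ^ 'n) set"
    and \<zeta> :: "real ^ 'd"
  assumes "a < b" and "1 < q" and "CARD('d) > 1"
    and "convex_cone C" and "closed C" and "C \<noteq> UNIV"
    and "C1_on ({a..b} \<times> UNIV \<times> UNIV) (\<lambda>(t, y, p). L t y p)"
    and "\<And>i t y p. t \<in> {a..b} \<Longrightarrow>
           \<bar>L t y p $ i\<bar> \<le> K1 * (norm y powr q + norm p powr q + 1)"
    and "\<And>i t y p. t \<in> {a..b} \<Longrightarrow>
           norm (grad (\<lambda>p'. L t y p' $ i) p) \<le> K2 * (norm y powr (q - 1) + norm p powr (q - 1) + 1)"
    and "\<And>i t y p. t \<in> {a..b} \<Longrightarrow>
           norm (grad (\<lambda>y'. L t y' p $ i) y) \<le> K2 * (norm y powr (q - 1) + norm p powr (q - 1) + 1)"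
    and "infimizer q a b A B L C M"
    and "\<zeta> \<in> dual_cone C - {0}"
    and "\<exists>y\<^sub>\<zeta> \<in> M. zeta_solution q a b A B L \<zeta> y\<^sub>\<zeta>"
  shows "frechet_differentiable_at_0 q a b (phi a b L C \<zeta> M) \<and>
         (\<forall>v \<in> W1q_0 q a b.
            has_zeta_deriv \<zeta> (Jhat a b L C M) (\<lambda>_. 0) v
              (S_map (frechet_deriv_at_0 q a b (phi a b L C \<zeta> M)) \<zeta> v) \<and>
            S_map (frechet_deriv_at_0 q a b (phi a b L C \<zeta> M)) \<zeta> v = Hplus \<zeta>)"
proof -
  let ?\<Phi> = "phi a b L C \<zeta> M"
  have q: "1 \<le> q"
    using \<open>1 < q\<close> by simp
  obtain y0 where y0: "y0 \<in> M" "zeta_solution q a b A B L \<zeta> y0"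
    using assms(13) by blast
  then have y0X: "y0 \<in> X1 q a b A B" and y0W: "y0 \<in> W1q q a b"
    by (auto simp: zeta_solution_def X1_def)
  have MX: "M \<subseteq> X1 q a b A B"
    using assms(11) by (simp add: infimizer_def)
  have min: "Jzeta a b L \<zeta> y0 \<le> Jzeta a b L \<zeta> y" if "y \<in> X1 q a b A B" for y
  proof -
    have "ereal (Jzeta a b L \<zeta> y0) \<le> ereal (Jzeta a b L \<zeta> y)"
      using y0(2) that unfolding zeta_solution_def by (metis INF_lower)
    then show ?thesis
      by simp
  qed
  obtain \<kappa> D where "growth_integrand a b q \<kappa> (\<lambda>t z. \<zeta> \<bullet> L t (fst z) (snd z)) D"
    using C1_on_imp_growth_integrand[OF less_imp_le[OF \<open>a < b\<close>] \<open>1 < q\<close> assms(7,9,10)] by blast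
  then interpret G: growth_integrand a b q \<kappa> "\<lambda>t z. \<zeta> \<bullet> L t (fst z) (snd z)" D .
  have intL: "integrable (lebesgue_on {a..b}) (\<lambda>t. L t (y t) (wderiv a b y t))" if "y \<in> W1q q a b" for y
    by (rule integrable_Lagrangian[OF \<open>1 < q\<close> C1_on_imp_continuous_on[OF assms(7)] assms(8) that])
  interpret V: variational_functional a b q \<kappa> "\<lambda>t z. \<zeta> \<bullet> L t (fst z) (snd z)" D y0
    by unfold_locales (use y0W intL in auto)
  have F: "V.F y = Jzeta a b L \<zeta> y" if "y \<in> W1q q a b" for y
    using intL[OF that] by (simp add: V.F_def Jzeta_def J_def)
  have W0: "(\<lambda>t. y0 t + v t) \<in> W1q q a b" if "v \<in> W1q_0 q a b" for v
    using X1_add_W1q_0[OF y0X that q] by (simp add: X1_def)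
  have upper: "\<exists>\<delta>>0. \<forall>v \<in> W1q_0 q a b. W1q_norm q a b v < \<delta> \<longrightarrow>
      Jzeta a b L \<zeta> (\<lambda>t. y0 t + v t) \<le> Jzeta a b L \<zeta> y0 + e * W1q_norm q a b v" if "e > 0" for e
    using V.F_le_if_minimizer[OF _ that] min[OF X1_add_W1q_0[OF y0X _ q]] by (simp add: F W0 y0W)
  have phi: "ereal (Jzeta a b L \<zeta> y0) \<le> ?\<Phi> v" "?\<Phi> v \<le> ereal (Jzeta a b L \<zeta> (\<lambda>t. y0 t + v t))"
    if "v \<in> W1q_0 q a b" for v
  proof -
    have "Jzeta a b L \<zeta> y0 \<le> Jzeta a b L \<zeta> (\<lambda>t. y t + v t)" if "y \<in> M" for y
      using that MX \<open>v \<in> W1q_0 q a b\<close> q by (intro min X1_add_W1q_0) auto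
    from phi_bounds[OF assms(4) _ y0(1) this] assms(12)
    show "ereal (Jzeta a b L \<zeta> y0) \<le> ?\<Phi> v" "?\<Phi> v \<le> ereal (Jzeta a b L \<zeta> (\<lambda>t. y0 t + v t))"
      by auto
  qed
  \<comment> \<open>The two bounds squeeze \<Phi> between reals on W_0^{1,q}, so the conversion
    loses nothing there; elsewhere \<phi> may be a default value.\<close>
  define \<phi> where "\<phi> v = real_of_ereal (?\<Phi> v)" for v
  have phi_eq: "?\<Phi> v = ereal (\<phi> v)" if "v \<in> W1q_0 q a b" for v
    using phi[OF that] unfolding \<phi>_def by (cases "?\<Phi> v") auto
  have \<phi>_bounds: "Jzeta a b L \<zeta> y0 \<le> \<phi> v" "\<phi> v \<le> Jzeta a b L \<zeta> (\<lambda>t. y0 t + v t)"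
    if "v \<in> W1q_0 q a b" for v
    using phi[OF that] by (simp_all add: phi_eq[OF that])
  \<comment> \<open>At v = 0 the lower and the upper bound coincide.\<close>
  have \<phi>0: "\<phi> (\<lambda>_. 0) = Jzeta a b L \<zeta> y0"
    using \<phi>_bounds[OF W1q_0_0] by simp
  have \<phi>_min: "\<phi> (\<lambda>_. 0) \<le> \<phi> v" if "v \<in> W1q_0 q a b" for v
    using \<phi>_bounds(1)[OF that] by (simp add: \<phi>0)
  have \<phi>_small: "\<exists>\<delta>>0. \<forall>v \<in> W1q_0 q a b. W1q_norm q a b v < \<delta> \<longrightarrow>
      \<phi> v \<le> \<phi> (\<lambda>_. 0) + e * W1q_norm q a b v" if "e > 0" for e
    using upper[OF that] \<phi>_bounds(2) unfolding \<phi>0 by (meson order.trans)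
  have deriv0: "has_frechet_deriv_at_0 q a b ?\<Phi> (\<lambda>_. 0)"
    by (rule has_frechet_deriv_at_0_zero[OF phi_eq \<phi>_min \<phi>_small])
  then have "has_frechet_deriv_at_0 q a b ?\<Phi> (frechet_deriv_at_0 q a b ?\<Phi>)"
    unfolding frechet_deriv_at_0_def by (rule someI[of "has_frechet_deriv_at_0 q a b ?\<Phi>"])
  \<comment> \<open>The chosen derivative need not be the zero functional everywhere; uniqueness
    makes it vanish on W_0^{1,q}, which is all that \<open>S_map\<close> is evaluated on.\<close>
  then have "frechet_deriv_at_0 q a b ?\<Phi> v = 0" if "v \<in> W1q_0 q a b" for v
    using has_frechet_deriv_at_0_unique[OF q _ deriv0 that] by blast
  then have S: "S_map (frechet_deriv_at_0 q a b ?\<Phi>) \<zeta> v = Hplus \<zeta>" if "v \<in> W1q_0 q a b" for v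
    using that by (simp add: S_map_def Hplus_def)
  have "has_zeta_deriv \<zeta> (Jhat a b L C M) (\<lambda>_. 0) v (Hplus \<zeta>)" if "v \<in> W1q_0 q a b" for v
    using assms(12) by (intro has_zeta_deriv_Hplus[OF q _ _ \<phi>_min \<phi>_small that])
      (auto simp flip: phi_eq phi_def)
  then show ?thesis
    using deriv0 S by (auto simp: frechet_differentiable_at_0_def)
qed

end
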